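(* Consider the urn model described in the context, and assume that there is an integer constant $C$ with $A_n\vee B_n\vee N_n\le C$ for all $n\ge 1$, and that $E[A_n]=E[B_n]=m_n$ for all $n$, with $m_n\to m\in(0,+\infty)$. Then, for every $n\ge 1$, almost surely $$\bigl|E[Z_{n+1}\,|\,\mathcal G_n]-Z_n\bigr|\le E[(A_{n+1}+B_{n+1})^2]\,\frac{N_{n+1}^2}{n^2},$$ and so the process $(Z_n)$ is a $\mathcal G$-quasi-martingale and it converges almost surely to a random variable $Z$ taking values in $[0,1]$.
   Context: Urn model. An urn initially contains $a\ge 1$ balls of color A and $b\ge 1$ balls of color B ($a,b$ integers). On a probability space $(\Omega,\mathcal A,P)$ there are random variables $N_n,X_n,A_n,B_n$, $n\ge 1$, where $N_n$ is the size of the sample drawn without replacement at time $n$, $X_n$ is the number of sampled balls of color A, and after the draw the sampled balls are returned together with $A_nX_n$ new balls of color A and $B_n(N_n-X_n)$ new balls of color B. Put, for $n\ge 0$, $H_n=a+\sum_{j=1}^n A_jX_j$ (balls of color A), $K_n=b+\sum_{j=1}^n B_j(N_j-X_j)$ (balls of color B), $S_n=H_n+K_n$. For each $n\ge1$: (A1) the conditional distribution of $N_n$ given $[N_1,X_1,A_1,B_1,\dots,N_{n-1},X_{n-1},A_{n-1},B_{n-1}]$ is concentrated on $\{1,\dots,S_{n-1}\}$; (A2) the conditional distribution of $X_n$ given $[N_1,X_1,A_1,B_1,\dots,N_{n-1},X_{n-1},A_{n-1},B_{n-1},N_n]$ is hypergeometric with parameters $N_n,S_{n-1},H_{n-1}$,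 i.e. it gives mass $\binom{H_{n-1}}{k}\binom{S_{n-1}-H_{n-1}}{N_n-k}/\binom{S_{n-1}}{N_n}$ to $k$; (A3) the random vector $[A_n,B_n]$ takes values in $(\mathbb N\setminus\{0\})^2$ and is independent of $[N_1,X_1,A_1,B_1,\dots,N_{n-1},X_{n-1},A_{n-1},B_{n-1},N_n,X_n]$ ($A_n$ and $B_n$ may be correlated with each other and their law may depend on $n$). The proportion of balls of color A is $Z_n=H_n/S_n$, $n\ge0$. Filtrations: $\mathcal F_0=\{\emptyset,\Omega\}$, $\mathcal F_n=\sigma(N_1,X_1,A_1,B_1,\dots,N_n,X_n,A_n,B_n)$ for $n\ge1$, and $\mathcal G=(\mathcal G_n)_{n\ge0}$ with $\mathcal G_n=\mathcal F_n\vee\sigma(N_{n+1})$. A $\mathcal G$-quasi-martingale is an integrable $\mathcal G$-adapted process $(Y_n)$ with $\sum_n E\bigl[|E[Y_{n+1}|\mathcal G_n]-Y_n|\bigr]<+\infty$. *)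

theory Defs
  imports "HOL-Probability.Probability"
begin

definition sigma_gen :: "'w measure \<Rightarrow> ('w \<Rightarrow> 'b) \<Rightarrow> 'w measure" where
  "sigma_gen M Y = vimage_algebra (space M) Y (count_space UNIV)"

(* Conditional distributions of nat-valued random variables are given by their mass functions:
   this is (a version of) P(Y = k | F). *)
definition cond_mass :: "'w measure \<Rightarrow> 'w measure \<Rightarrow> ('w \<Rightarrow> nat) \<Rightarrow> nat \<Rightarrow> 'w \<Rightarrow> real" where
  "cond_mass M F Y k = real_cond_exp M F (indicator {\<omega> \<in> space M. Y \<omega> = k})"

(* Sample size r, population size s, h marked individuals. The case k > r is separate because
   r - k is truncated on nat. *)
definition hypergeometric_mass :: "nat \<Rightarrow> nat \<Rightarrow> nat \<Rightarrow> nat \<Rightarrow> real" where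
  "hypergeometric_mass r s h k =
     (if k \<le> r then real (h choose k) * real ((s - h) choose (r - k)) / real (s choose r) else 0)"

definition quasi_martingale ::
  "'w measure \<Rightarrow> (nat \<Rightarrow> 'w measure) \<Rightarrow> (nat \<Rightarrow> 'w \<Rightarrow> real) \<Rightarrow> bool" where
  "quasi_martingale M G Y \<longleftrightarrow>
     filtration (space M) G \<and> (\<forall>n. subalgebra M (G n)) \<and>
     (\<forall>n. Y n \<in> borel_measurable (G n)) \<and> (\<forall>n. integrable M (Y n)) \<and>
     summable (\<lambda>n. \<integral>\<omega>. \<bar>real_cond_exp M (G n) (Y (Suc n)) \<omega> - Y n \<omega>\<bar> \<partial>M)"

(* The sequences N, X, A, B are indexed from time 1; their values at index 0 are never used. *)
locale urn_process =
  fixes M :: "'w measure" and a b :: nat and N X A B :: "nat \<Rightarrow> 'w \<Rightarrow> nat"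
begin

definition H :: "nat \<Rightarrow> 'w \<Rightarrow> nat" where
  "H n \<omega> = a + (\<Sum>j=1..n. A j \<omega> * X j \<omega>)"

(* In the urn model X j \<le> N j holds almost surely, so the truncation of the subtraction on nat
   is only visible on a null set. *)
definition K :: "nat \<Rightarrow> 'w \<Rightarrow> nat" where
  "K n \<omega> = b + (\<Sum>j=1..n. B j \<omega> * (N j \<omega> - X j \<omega>))"

definition S :: "nat \<Rightarrow> 'w \<Rightarrow> nat" where
  "S n \<omega> = H n \<omega> + K n \<omega>"

definition Z :: "nat \<Rightarrow> 'w \<Rightarrow> real" where
  "Z n \<omega> = real (H n \<omega>) / real (S n \<omega>)"

definition hist :: "nat \<Rightarrow> 'w \<Rightarrow> (nat \<times> nat \<times> nat \<times> nat) list" where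
  "hist n \<omega> = map (\<lambda>j. (N j \<omega>, X j \<omega>, A j \<omega>, B j \<omega>)) [1..<Suc n]"

(* hist takes values in a countable type, so this is the sigma-algebra generated by
   N j, X j, A j, B j for 1 \<le> j \<le> n. It is trivial for n = 0. *)
definition F :: "nat \<Rightarrow> 'w measure" where
  "F n = sigma_gen M (hist n)"

definition G :: "nat \<Rightarrow> 'w measure" where
  "G n = sigma (space M) (sets (F n) \<union> sets (sigma_gen M (N (Suc n))))"

end

(* The hypotheses at time n \<ge> 1 are written at time Suc n. The conditioning in X_mass is on
   the history up to time n together with N (Suc n), that is, on G n. *)
locale urn_model = prob_space M + urn_process M a b N X A B
  for M :: "'w measure" and a b :: nat and N X A B :: "nat \<Rightarrow> 'w \<Rightarrow> nat" +
  assumes a_pos: "a \<ge> 1" and b_pos: "b \<ge> 1"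
    and rv_N: "\<And>n. N (Suc n) \<in> measurable M (count_space UNIV)"
    and rv_X: "\<And>n. X (Suc n) \<in> measurable M (count_space UNIV)"
    and rv_A: "\<And>n. A (Suc n) \<in> measurable M (count_space UNIV)"
    and rv_B: "\<And>n. B (Suc n) \<in> measurable M (count_space UNIV)"
    and N_conc: "\<And>n. AE \<omega> in M. (\<Sum>k=1..S n \<omega>. cond_mass M (F n) (N (Suc n)) k \<omega>) = 1"
    and X_mass: "\<And>n k. AE \<omega> in M. cond_mass M (G n) (X (Suc n)) k \<omega> =
                   hypergeometric_mass (N (Suc n) \<omega>) (S n \<omega>) (H n \<omega>) k"
    and AB_pos: "\<And>n. AE \<omega> in M. A (Suc n) \<omega> \<noteq> 0 \<and> B (Suc n) \<omega> \<noteq> 0"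
    and AB_indep: "\<And>n. indep_set
                     (sets (sigma_gen M (\<lambda>\<omega>. (A (Suc n) \<omega>, B (Suc n) \<omega>))))
                     (sets (sigma_gen M (\<lambda>\<omega>. (hist n \<omega>, N (Suc n) \<omega>, X (Suc n) \<omega>))))"

end

theory Submission
  imports Defs
begin

text \<open>
  Freezing the size of the urn in the denominator splits an increment of \<open>Z\<close> into a linear part
  \<open>V\<close> and a remainder of order \<open>1 / n\<^sup>2\<close>. The linear part is centred given \<open>G n\<close>, because
  the numbers of added balls have equal means and are independent of the sample, whose expected
  composition is that of the urn. This gives the conditional bound, and the remainders are summable.

  For the convergence of \<open>\<Sum> V n\<close> no martingale convergence theorem is needed: the terms are
  orthogonal and of order \<open>1 / n\<close>, so the sum over the block from \<open>(j + 1)\<^sup>3\<close> to \<open>(j + 2)\<^sup>3\<close> has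
  second moment of order \<open>1 / j\<^sup>4\<close>. The block sums are therefore almost surely absolutely summable,
  and inside a block the partial sums vary by at most a constant times \<open>1 / j\<close>.
\<close>

section \<open>Hypergeometric mean\<close>

text \<open>\<open>Z\<close> is not linear in the added balls, and \<open>A\<close>,
  \<open>B\<close> may be correlated, so equal means do not settle the exact increment. They do
  settle its linearisation: both terms of \<open>V\<close> have conditional mean m N H K / S^3. The
  order 1/n comes from the growth of the urn by at least one ball per step.

  Since the law of the sample is given through conditional masses, centring is proved in weak form:
  the integral of \<open>V n\<close> against any bounded \<open>G n\<close>-measurable function
  vanishes. Indicators then give the conditional expectation, and sums of earlier \<open>V i\<close>
  give orthogonality.

  Why cubes: the block starting at j^3 has O(j^2) terms of order j^-3. Its second moment, O(j^-4),
  remains summable after multiplication by j^2, and this weight turns second moments into absolute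
  sums through 2y \<le> j^2 y^2 + j^-2. Inside the block the partial sums move by O(j^2 j^-3), which
  tends to 0. Between consecutive squares the weighted second moments would only be O(1/j); dyadic
  blocks would allow a variation of order 1.\<close>

lemma sum_times_choose:
  assumes "h \<le> s" "1 \<le> r"
  shows "(\<Sum>k\<le>r. k * ((h choose k) * ((s - h) choose (r - k)))) = h * ((s - 1) choose (r - 1))"
proof (cases "h = 0")
  case True
  then show ?thesis by (auto intro!: sum.neutral simp: binomial_eq_0)
next
  case False
  obtain q where r: "r = Suc q" using assms(2) by (cases r) auto
  obtain g where h: "h = Suc g" using False by (cases h) auto
  \<comment> \<open>The term k = 0 vanishes. After the shift, absorption
    (\<open>Suc_times_binomial\<close>) pulls the factor h out of each term, and what is left is a
    Vandermonde sum.\<close>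
  have "(\<Sum>k\<le>r. k * ((h choose k) * ((s - h) choose (r - k))))
      = (\<Sum>k\<le>q. Suc k * ((h choose Suc k) * ((s - h) choose (q - k))))"
    unfolding r by (subst sum.atMost_Suc_shift) simp
  also have "\<dots> = (\<Sum>k\<le>q. h * ((g choose k) * ((s - h) choose (q - k))))"
    unfolding h by (rule sum.cong) (auto simp: Suc_times_binomial mult.assoc[symmetric] simp del: mult_Suc binomial_Suc_Suc)
  also have "\<dots> = h * ((g + (s - h)) choose q)"
    by (simp only: sum_distrib_left[symmetric] vandermonde)
  also have "g + (s - h) = s - 1" using assms(1) h by simp
  finally show ?thesis using r by simp
qed

text \<open>The range of summation goes up to an arbitrary c \<ge> r because the sample size is
  random while its bound is fixed; masses beyond r are 0.\<close>

lemma hypergeometric_mass_mean: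
  assumes "h \<le> s" "1 \<le> r" "r \<le> s" "r \<le> c"
  shows "(\<Sum>k\<le>c. real k * hypergeometric_mass r s h k) = real r * real h / real s"
proof -
  have s: "s choose r > 0" using assms by simp
  have "r * (s choose r) = s * ((s - 1) choose (r - 1))"
    using assms times_binomial_minus1_eq[of r s] by simp
  then have *: "real r * real (s choose r) = real s * real ((s - 1) choose (r - 1))"
    by (metis of_nat_mult)
  have "(\<Sum>k\<le>c. real k * hypergeometric_mass r s h k) = (\<Sum>k\<le>r. real k * hypergeometric_mass r s h k)"
    using assms by (intro sum.mono_neutral_right) (auto simp: hypergeometric_mass_def)
  also have "\<dots> = real (\<Sum>k\<le>r. k * ((h choose k) * ((s - h) choose (r - k)))) / real (s choose r)"
    by (simp add: hypergeometric_mass_def sum_divide_distrib)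
  also have "\<dots> = real h * real ((s - 1) choose (r - 1)) / real (s choose r)"
    using sum_times_choose[OF assms(1,2)] by simp
  also have "\<dots> = real r * real h / real s"
    using * s assms(2,3) by (simp add: field_simps)
  finally show ?thesis .
qed

section \<open>Generated sigma-algebras and independence\<close>

lemma space_sigma_gen [simp]: "space (sigma_gen M Y) = space M"
  by (simp add: sigma_gen_def)

lemma measurable_sigma_gen: "Y \<in> measurable (sigma_gen M Y) (count_space UNIV)"
  unfolding sigma_gen_def by (rule measurable_vimage_algebra1) auto

lemma sets_sigma_gen_subset:
  assumes "Y \<in> measurable L (count_space UNIV)" "space L = space M"
  shows "sets (sigma_gen M Y) \<subseteq> sets L"
  using assms unfolding sigma_gen_def
  by (subst sets_vimage_algebra2) (auto simp: measurable_def)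

text \<open>Fixing the value of f leaves a function of g alone; countably many such pieces are
  glued. This keeps pairs and lists on discrete spaces, without product sigma-algebras.\<close>

lemma measurable_count_space2:
  fixes f :: "'w \<Rightarrow> 'b::countable" and g :: "'w \<Rightarrow> 'c::countable"
  assumes "f \<in> measurable M (count_space UNIV)" "g \<in> measurable M (count_space UNIV)"
  shows "(\<lambda>\<omega>. h (f \<omega>) (g \<omega>)) \<in> measurable M (count_space UNIV)"
proof -
  have "(\<lambda>\<omega>. h i (g \<omega>)) \<in> measurable M (count_space UNIV)" for i
    using assms(2) by (rule measurable_compose) simp
  from measurable_compose_countable[OF this assms(1)] show ?thesis .
qed

text \<open>The model states independence for set systems. Preimages of Borel sets under f and g lie
  in P and Q, so independence passes to the variables, and the product rule for expectations
  applies.\<close>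

lemma (in prob_space) indep_set_integral_mult:
  fixes f g :: "'a \<Rightarrow> real"
  assumes ind: "indep_set (sets P) (sets Q)"
    and P: "subalgebra M P" and Q: "subalgebra M Q"
    and f: "f \<in> borel_measurable P" "integrable M f"
    and g: "g \<in> borel_measurable Q" "integrable M g"
  shows "(\<integral>\<omega>. f \<omega> * g \<omega> \<partial>M) = (\<integral>\<omega>. f \<omega> \<partial>M) * (\<integral>\<omega>. g \<omega> \<partial>M)"
proof (rule indep_var_lebesgue_integral)
  have sub: "sigma_sets (space M) {u -` A \<inter> space M |A. A \<in> sets borel} \<subseteq> sets L"
    if "subalgebra M L" "u \<in> borel_measurable L" for L and u :: "'a \<Rightarrow> real"
  proof -
    have "space L = space M" using that(1) by (simp add: subalgebra_def)
    then show ?thesis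
      using measurable_sets[OF that(2)] sets.sigma_sets_subset[of "{u -` A \<inter> space M |A. A \<in> sets borel}" L]
      by auto
  qed
  show "indep_var borel f borel g"
    unfolding indep_var_eq
  proof safe
    show "random_variable borel f" "random_variable borel g"
      using measurable_from_subalg P Q f g by auto
    show "indep_set (sigma_sets (space M) {f -` A \<inter> space M |A. A \<in> sets borel})
        (sigma_sets (space M) {g -` A \<inter> space M |A. A \<in> sets borel})"
      using ind sub[OF P f(1)] sub[OF Q g(1)] unfolding indep_set_def
      by (elim indep_sets_mono_sets) (auto split: bool.split)
  qed
qed (use f g in auto)

text \<open>Every test set of R is also in Q, hence independent of f. A smaller R is allowed because
  the added balls are independent of the whole sample, while the conditioning is on
  \<open>G n\<close> only.\<close>

lemma (in prob_space) indep_set_real_cond_exp: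
  fixes f :: "'a \<Rightarrow> real"
  assumes ind: "indep_set (sets P) (sets Q)"
    and P: "subalgebra M P" and Q: "subalgebra M Q" and sub: "sets R \<subseteq> sets Q" "subalgebra M R"
    and f: "f \<in> borel_measurable P" "integrable M f"
  shows "AE \<omega> in M. real_cond_exp M R f \<omega> = (\<integral>\<omega>. f \<omega> \<partial>M)"
proof -
  interpret finite_measure_subalgebra M R using sub by unfold_locales
  show ?thesis
  proof (rule real_cond_exp_charact)
    fix D assume D: "D \<in> sets R"
    then have "D \<in> sets Q" "D \<in> sets M" using sub by (auto simp: subalgebra_def)
    then have "(\<integral>\<omega>. f \<omega> * indicator D \<omega> \<partial>M) = (\<integral>\<omega>. f \<omega> \<partial>M) * (\<integral>\<omega>. indicator D \<omega> \<partial>M)"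
      by (intro indep_set_integral_mult[OF ind P Q f]) (auto simp: less_top[symmetric])
    then show "(\<integral>\<omega>\<in>D. f \<omega> \<partial>M) = (\<integral>\<omega>\<in>D. (\<integral>\<omega>. f \<omega> \<partial>M) \<partial>M)"
      by (simp add: set_lebesgue_integral_def mult.commute)
  qed (use f in auto)
qed

section \<open>Almost sure convergence from summable second moments\<close>

text \<open>By monotone convergence the series has a finite integral, so it is finite almost
  everywhere.\<close>

lemma AE_summable_of_summable_integral:
  fixes f :: "nat \<Rightarrow> 'a \<Rightarrow> real"
  assumes int: "\<And>n. integrable M (f n)" and pos: "\<And>n \<omega>. f n \<omega> \<ge> 0"
    and sum: "summable (\<lambda>n. \<integral>\<omega>. f n \<omega> \<partial>M)"
  shows "AE \<omega> in M. summable (\<lambda>n. f n \<omega>)"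
proof -
  have [measurable]: "f n \<in> borel_measurable M" for n using int by auto
  have "(\<integral>\<^sup>+\<omega>. (\<Sum>n. ennreal (f n \<omega>)) \<partial>M) = (\<Sum>n. \<integral>\<^sup>+\<omega>. ennreal (f n \<omega>) \<partial>M)"
    by (rule nn_integral_suminf) auto
  also have "\<dots> = (\<Sum>n. ennreal (\<integral>\<omega>. f n \<omega> \<partial>M))"
    using int pos by (simp add: nn_integral_eq_integral)
  also have "\<dots> = ennreal (\<Sum>n. \<integral>\<omega>. f n \<omega> \<partial>M)"
    using pos sum by (intro suminf_ennreal2) auto
  finally have "(\<integral>\<^sup>+\<omega>. (\<Sum>n. ennreal (f n \<omega>)) \<partial>M) \<noteq> \<infinity>" by simp
  then have "AE \<omega> in M. (\<Sum>n. ennreal (f n \<omega>)) \<noteq> \<infinity>"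
    by (intro nn_integral_PInf_AE) auto
  then show ?thesis
    by eventually_elim (use pos in \<open>auto intro: summable_suminf_not_top\<close>)
qed

lemma summable_over_square: "summable (\<lambda>n. c / (real n + 1)\<^sup>2)" for c :: real
proof -
  have "summable (\<lambda>n. c * inverse ((real (Suc n))\<^sup>2))"
    using inverse_power_summable[of 2, where 'a=real]
    by (intro summable_mult) (subst summable_Suc_iff, simp)
  then show ?thesis by (simp add: divide_inverse add.commute)
qed

section \<open>Real sequences controlled along the cubes\<close>

lemma sum_increments_bound:
  fixes w :: "nat \<Rightarrow> real"
  assumes "p \<le> q" and inc: "\<And>n. \<bar>w (Suc n) - w n\<bar> \<le> c / (real n + 1)"
  shows "\<bar>w q - w p\<bar> \<le> (real q - real p) * c / (real p + 1)"
  using \<open>p \<le> q\<close>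
proof (induction q rule: dec_induct)
  case (step n)
  \<comment> \<open>At index 0 the denominator is 1, so c dominates an absolute value.\<close>
  have "c \<ge> 0" using inc[of 0] by auto
  then have "c / (real n + 1) \<le> c / (real p + 1)" using step by (intro divide_left_mono) auto
  then have "\<bar>w (Suc n) - w p\<bar> \<le> (real n - real p) * c / (real p + 1) + c / (real p + 1)"
    using step inc[of n] by linarith
  then show ?case by (simp add: add_divide_distrib[symmetric] algebra_simps)
qed simp

text \<open>With x = j + 1 \<ge> 1 the gap is 3x^2 + 3x + 1, and 3 + 3 + 1 = 7.\<close>

lemma cube_gap: "real ((j + 2) ^ 3) - real ((j + 1) ^ 3) \<le> 7 * (real j + 1)\<^sup>2"
proof -
  have "(real j + 2) ^ 3 - (real j + 1) ^ 3 \<le> 7 * (real j + 1)\<^sup>2"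
    by (simp add: power3_eq_cube power2_eq_square algebra_simps)
  then show ?thesis by (simp add: ac_simps)
qed

lemma convergent_from_cubes:
  fixes w :: "nat \<Rightarrow> real"
  assumes inc: "\<And>n. \<bar>w (Suc n) - w n\<bar> \<le> c / (real n + 1)"
    and conv: "convergent (\<lambda>j. w ((j + 1) ^ 3))"
  shows "convergent w"
proof -
  have c: "c \<ge> 0" using inc[of 0] by auto
  obtain l where l: "(\<lambda>j. w ((j + 1) ^ 3)) \<longlonglongrightarrow> l" using conv by (auto simp: convergent_def)
  have "(\<lambda>j. 7 * c / (real j + 1)) \<longlonglongrightarrow> 0"
    using tendsto_mult[OF tendsto_const[of "7 * c"] LIMSEQ_inverse_real_of_nat]
    by (simp add: divide_inverse add.commute)
  then have lim: "(\<lambda>j. \<bar>w ((j + 1) ^ 3) - l\<bar> + 7 * c / (real j + 1)) \<longlonglongrightarrow> 0"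
    using tendsto_rabs_zero[OF l[unfolded LIM_zero_iff[symmetric, of _ l]]]
    by (auto intro: tendsto_add_zero)
  have "w \<longlonglongrightarrow> l"
  proof (rule LIMSEQ_I)
    fix e :: real assume "e > 0"
    then obtain J where J: "\<And>j. j \<ge> J \<Longrightarrow> \<bar>w ((j + 1) ^ 3) - l\<bar> + 7 * c / (real j + 1) < e"
      using LIMSEQ_D[OF lim, of e] by (auto simp: abs_less_iff)
    have "norm (w n - l) < e" if n: "n \<ge> (J + 1) ^ 3" for n
    proof -
      \<comment> \<open>The block containing n is found by induction on n: either
        \<open>Suc n\<close> stays in the block of n, or it is exactly the left end of the next
        one.\<close>
      have "\<exists>j\<ge>J. (j + 1) ^ 3 \<le> n \<and> n < (j + 2) ^ 3"
        using n
      proof (induction n rule: dec_induct)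
        case base
        have "(J + 1) ^ 3 < (J + 2) ^ 3" by (rule power_strict_mono) auto
        then show ?case by blast
      next
        case (step n)
        then obtain j where j: "j \<ge> J" "(j + 1) ^ 3 \<le> n" "n < (j + 2) ^ 3" by blast
        show ?case
        proof (cases "Suc n < (j + 2) ^ 3")
          case True
          then show ?thesis using j by (intro exI[of _ j]) auto
        next
          case False
          then have "Suc n = (Suc j + 1) ^ 3" using j by simp
          moreover have "(Suc j + 1) ^ 3 < (Suc j + 2) ^ 3" by (rule power_strict_mono) auto
          ultimately show ?thesis using j by (intro exI[of _ "Suc j"]) auto
        qed
      qed
      then obtain j where j: "j \<ge> J" "(j + 1) ^ 3 \<le> n" "n < (j + 2) ^ 3" by blast
      define q where "q = real j + 1"
      have q: "q > 0" by (simp add: q_def)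
      have r: "real ((j + 1) ^ 3) = q ^ 3" by (simp add: q_def add.commute)
      have "\<bar>w n - w ((j + 1) ^ 3)\<bar> \<le> (real n - real ((j + 1) ^ 3)) * c / (real ((j + 1) ^ 3) + 1)"
        by (rule sum_increments_bound[OF j(2) inc])
      also have "\<dots> \<le> (7 * q\<^sup>2) * c / (real ((j + 1) ^ 3) + 1)"
      proof (intro divide_right_mono mult_right_mono)
        have "real n \<le> real ((j + 2) ^ 3)" using j(3) by linarith
        then show "real n - real ((j + 1) ^ 3) \<le> 7 * q\<^sup>2"
          using cube_gap[of j] unfolding q_def by linarith
      qed (use c in auto)
      also have "\<dots> \<le> (7 * q\<^sup>2) * c / q ^ 3"
        using q c unfolding r by (intro divide_left_mono mult_pos_pos) (auto intro: add_pos_pos)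
      also have "\<dots> = 7 * c / (real j + 1)"
        using q by (simp add: q_def[symmetric] power3_eq_cube power2_eq_square)
      finally show ?thesis using J[OF j(1)] by (auto simp: abs_le_iff abs_less_iff)
    qed
    then show "\<exists>no. \<forall>n\<ge>no. norm (w n - l) < e" by blast
  qed
  then show ?thesis by (auto simp: convergent_def)
qed

section \<open>The filtrations of the urn\<close>

context urn_model
begin

lemma hist_Suc: "hist (Suc n) \<omega> = hist n \<omega> @ [(N (Suc n) \<omega>, X (Suc n) \<omega>, A (Suc n) \<omega>, B (Suc n) \<omega>)]"
  by (simp add: hist_def)

text \<open>L is arbitrary: with L = M this makes \<open>F n\<close> a sub-sigma-algebra, with L =
  \<open>F k\<close> it makes the filtration monotone.\<close>

lemma measurable_hist:
  assumes "\<And>i. i < n \<Longrightarrow> N (Suc i) \<in> measurable L (count_space UNIV)"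
    and "\<And>i. i < n \<Longrightarrow> X (Suc i) \<in> measurable L (count_space UNIV)"
    and "\<And>i. i < n \<Longrightarrow> A (Suc i) \<in> measurable L (count_space UNIV)"
    and "\<And>i. i < n \<Longrightarrow> B (Suc i) \<in> measurable L (count_space UNIV)"
  shows "hist n \<in> measurable L (count_space UNIV)"
  using assms
proof (induction n)
  case 0
  then show ?case by (simp add: hist_def)
next
  case (Suc n)
  have ih: "hist n \<in> measurable L (count_space UNIV)"
    by (rule Suc.IH) (rule Suc.prems, erule less_SucI)+
  have ab: "(\<lambda>\<omega>. (A (Suc n) \<omega>, B (Suc n) \<omega>)) \<in> measurable L (count_space UNIV)"
    by (rule measurable_count_space2[OF Suc.prems(3,4)[OF lessI]])
  have xab: "(\<lambda>\<omega>. (X (Suc n) \<omega>, A (Suc n) \<omega>, B (Suc n) \<omega>)) \<in> measurable L (count_space UNIV)"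
    by (rule measurable_count_space2[OF Suc.prems(2)[OF lessI] ab])
  have nxab: "(\<lambda>\<omega>. (N (Suc n) \<omega>, X (Suc n) \<omega>, A (Suc n) \<omega>, B (Suc n) \<omega>)) \<in> measurable L (count_space UNIV)"
    by (rule measurable_count_space2[OF Suc.prems(1)[OF lessI] xab])
  show ?case
    unfolding hist_Suc[abs_def] by (rule measurable_count_space2[OF ih nxab])
qed

lemma measurable_F:
  assumes "i < n"
  shows "N (Suc i) \<in> measurable (F n) (count_space UNIV)"
    and "X (Suc i) \<in> measurable (F n) (count_space UNIV)"
    and "A (Suc i) \<in> measurable (F n) (count_space UNIV)"
    and "B (Suc i) \<in> measurable (F n) (count_space UNIV)"
proof -
  have *: "hist n \<omega> ! i = (N (Suc i) \<omega>, X (Suc i) \<omega>, A (Suc i) \<omega>, B (Suc i) \<omega>)" for \<omega>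
    using assms by (simp add: hist_def del: upt_Suc)
  \<comment> \<open>Each variable is recovered from the history as a component of its i-th entry;
    every function on a discrete space is measurable.\<close>
  have "(\<lambda>\<omega>. f (hist n \<omega> ! i)) \<in> measurable (F n) (count_space UNIV)" for f :: "nat \<times> nat \<times> nat \<times> nat \<Rightarrow> nat"
    using measurable_sigma_gen[of "hist n" M] unfolding F_def by (rule measurable_compose) simp
  from this[of fst] this[of "fst \<circ> snd"] this[of "fst \<circ> snd \<circ> snd"] this[of "snd \<circ> snd \<circ> snd"]
  show "N (Suc i) \<in> measurable (F n) (count_space UNIV)"
    "X (Suc i) \<in> measurable (F n) (count_space UNIV)"
    "A (Suc i) \<in> measurable (F n) (count_space UNIV)"
    "B (Suc i) \<in> measurable (F n) (count_space UNIV)"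
    by (simp_all add: *)
qed

lemma space_F [simp]: "space (F n) = space M"
  by (simp add: F_def)

lemma space_G [simp]: "space (G n) = space M"
  unfolding G_def
  using sets.sets_into_space[of _ "F n"] sets.sets_into_space[of _ "sigma_gen M (N (Suc n))"]
  by (intro space_measure_of) auto

lemma subalgebra_M_F: "subalgebra M (F n)"
  unfolding subalgebra_def F_def
  using sets_sigma_gen_subset[OF measurable_hist] rv_N rv_X rv_A rv_B by simp

lemma subalgebra_F_mono: "n \<le> k \<Longrightarrow> subalgebra (F k) (F n)"
  unfolding subalgebra_def F_def[of n]
  using sets_sigma_gen_subset[OF measurable_hist[of n "F k"], of M] measurable_F[of _ k] by simp

lemma sets_G: "sets (G n) = sigma_sets (space M) (sets (F n) \<union> sets (sigma_gen M (N (Suc n))))"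
  unfolding G_def
  using sets.sets_into_space[of _ "F n"] sets.sets_into_space[of _ "sigma_gen M (N (Suc n))"]
  by (intro sets_measure_of) auto

text \<open>Minimality of the generated sigma-algebra. It places \<open>G n\<close> below M, below
  \<open>F (Suc n)\<close> and below the sigma-algebra of the sample data.\<close>

lemma sets_G_subset:
  assumes "subalgebra L (F n)" "N (Suc n) \<in> measurable L (count_space UNIV)"
  shows "subalgebra L (G n)"
proof -
  have sp: "space L = space M" using assms(1) by (simp add: subalgebra_def)
  have "sets (F n) \<union> sets (sigma_gen M (N (Suc n))) \<subseteq> sets L"
    using assms sets_sigma_gen_subset[OF assms(2) sp] by (auto simp: subalgebra_def)
  then have "sets (G n) \<subseteq> sets L"
    unfolding sets_G sp[symmetric] by (rule sets.sigma_sets_subset)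
  then show ?thesis using sp by (simp add: subalgebra_def)
qed

lemma subalgebra_G_F: "subalgebra (G n) (F n)"
  by (auto simp: subalgebra_def sets_G)

lemma measurable_G_N: "N (Suc n) \<in> measurable (G n) (count_space UNIV)"
proof -
  have "subalgebra (G n) (sigma_gen M (N (Suc n)))" by (auto simp: subalgebra_def sets_G)
  then show ?thesis using measurable_from_subalg measurable_sigma_gen by blast
qed

lemma subalgebra_M_G: "subalgebra M (G n)"
  by (intro sets_G_subset subalgebra_M_F rv_N)

lemma subalgebra_F_Suc_G: "subalgebra (F (Suc n)) (G n)"
  by (intro sets_G_subset subalgebra_F_mono measurable_F) auto

lemma subalgebra_trans: "subalgebra P Q \<Longrightarrow> subalgebra Q R \<Longrightarrow> subalgebra P R"
  by (auto simp: subalgebra_def)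

text \<open>\<open>F (Suc n)\<close> lies between \<open>G n\<close> and \<open>G (Suc n)\<close>:
  it already knows the sample size revealed at time n.\<close>

lemma subalgebra_G_mono: "n \<le> k \<Longrightarrow> subalgebra (G k) (G n)"
proof (induction k rule: dec_induct)
  case (step k)
  then show ?case
    using subalgebra_trans[OF subalgebra_trans[OF subalgebra_G_F subalgebra_F_Suc_G]] by blast
qed (simp add: subalgebra_def)

text \<open>Everything known just before the balls are added. It is finer than \<open>G n\<close>
  because it contains the composition of the sample, and it is the side from which
  \<open>AB_indep\<close> separates the added balls.\<close>

abbreviation obs :: "nat \<Rightarrow> 'w \<Rightarrow> (nat \<times> nat \<times> nat \<times> nat) list \<times> nat \<times> nat" where
  "obs n \<equiv> \<lambda>\<omega>. (hist n \<omega>, N (Suc n) \<omega>, X (Suc n) \<omega>)"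

lemma measurable_obs_comp: "(\<lambda>\<omega>. f (obs n \<omega>)) \<in> measurable (sigma_gen M (obs n)) (count_space UNIV)"
  using measurable_sigma_gen[of "obs n" M] by (rule measurable_compose) simp

lemma subalgebra_obs_G: "subalgebra (sigma_gen M (obs n)) (G n)"
proof (rule sets_G_subset)
  show "subalgebra (sigma_gen M (obs n)) (F n)"
    unfolding subalgebra_def F_def
    using sets_sigma_gen_subset[of "hist n" "sigma_gen M (obs n)" M] measurable_obs_comp[of fst n] by simp
  show "N (Suc n) \<in> measurable (sigma_gen M (obs n)) (count_space UNIV)"
    using measurable_obs_comp[of "fst \<circ> snd" n] by simp
qed

lemma measurable_obs_X: "X (Suc n) \<in> measurable (sigma_gen M (obs n)) (count_space UNIV)"
  using measurable_obs_comp[of "snd \<circ> snd" n] by simp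

lemma subalgebra_M_obs: "subalgebra M (sigma_gen M (obs n))"
proof -
  have "hist n \<in> measurable M (count_space UNIV)"
    using measurable_hist rv_N rv_X rv_A rv_B by blast
  then have "obs n \<in> measurable M (count_space UNIV)"
    by (intro measurable_count_space2[where h=Pair] rv_N rv_X)
  then show ?thesis using sets_sigma_gen_subset by (auto simp: subalgebra_def)
qed

abbreviation added :: "nat \<Rightarrow> 'w \<Rightarrow> nat \<times> nat" where
  "added n \<equiv> \<lambda>\<omega>. (A (Suc n) \<omega>, B (Suc n) \<omega>)"

lemma subalgebra_M_added: "subalgebra M (sigma_gen M (added n))"
proof -
  have "added n \<in> measurable M (count_space UNIV)"
    by (intro measurable_count_space2[where h=Pair] rv_A rv_B)
  then show ?thesis using sets_sigma_gen_subset by (auto simp: subalgebra_def)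
qed

lemma measurable_added: "(\<lambda>\<omega>. f (A (Suc n) \<omega>) (B (Suc n) \<omega>) :: real) \<in> borel_measurable (sigma_gen M (added n))"
  using measurable_compose[OF measurable_sigma_gen[of "added n" M], of "\<lambda>(x, y). f x y" borel] by simp

lemma measurable_urn [measurable]:
  "(\<lambda>\<omega>. real (H n \<omega>)) \<in> borel_measurable (F n)"
  "(\<lambda>\<omega>. real (K n \<omega>)) \<in> borel_measurable (F n)"
  "(\<lambda>\<omega>. real (S n \<omega>)) \<in> borel_measurable (F n)"
  "Z n \<in> borel_measurable (F n)"
proof -
  have [measurable]: "N i \<in> measurable (F n) (count_space UNIV)" "X i \<in> measurable (F n) (count_space UNIV)"
    "A i \<in> measurable (F n) (count_space UNIV)" "B i \<in> measurable (F n) (count_space UNIV)"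
    if "i \<in> {1..n}" for i
    using that measurable_F[of "i - 1" n] by auto
  show H: "(\<lambda>\<omega>. real (H n \<omega>)) \<in> borel_measurable (F n)"
    unfolding H_def of_nat_add of_nat_sum of_nat_mult by measurable
  have [measurable]: "(\<lambda>\<omega>. N i \<omega> - X i \<omega>) \<in> measurable (F n) (count_space UNIV)" if "i \<in> {1..n}" for i
    using that by (intro measurable_count_space2[where h=minus]) measurable
  show K: "(\<lambda>\<omega>. real (K n \<omega>)) \<in> borel_measurable (F n)"
    unfolding K_def of_nat_add of_nat_sum of_nat_mult by measurable
  show S: "(\<lambda>\<omega>. real (S n \<omega>)) \<in> borel_measurable (F n)"
    unfolding S_def of_nat_add using H K by measurable
  show "Z n \<in> borel_measurable (F n)"
    unfolding Z_def[abs_def] using H S by measurable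
qed

text \<open>The hypergeometric mass at k is 0 when k exceeds the sample size. The event that the
  sample size is below k belongs to \<open>G n\<close>, so integrating the conditional mass over it
  shows that X = k has probability 0 there.\<close>

lemma AE_X_le_N: "AE \<omega> in M. X (Suc n) \<omega> \<le> N (Suc n) \<omega>"
proof -
  interpret finite_measure_subalgebra M "G n" using subalgebra_M_G by unfold_locales
  have "AE \<omega> in M. \<not> (X (Suc n) \<omega> = k \<and> N (Suc n) \<omega> < k)" for k
  proof -
    let ?f = "\<lambda>\<omega>. (if N (Suc n) \<omega> < k then 1 else 0 :: real)"
    let ?g = "indicator {\<omega> \<in> space M. X (Suc n) \<omega> = k} :: 'w \<Rightarrow> real"
    have f: "?f \<in> borel_measurable (G n)"
      using measurable_compose[OF measurable_G_N, of "\<lambda>x. if x < k then 1 else 0 :: real" borel] by simp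
    have fM: "?f \<in> borel_measurable M" using measurable_from_subalg[OF subalgebra_M_G f] .
    have g: "?g \<in> borel_measurable M" using rv_X[of n] by measurable
    have int: "integrable M (\<lambda>\<omega>. ?f \<omega> * ?g \<omega>)"
      by (rule integrable_const_bound[where B=1]) (use borel_measurable_times[OF fM g] in \<open>auto simp: indicator_def\<close>)
    have "(\<integral>\<omega>. ?f \<omega> * ?g \<omega> \<partial>M) = (\<integral>\<omega>. ?f \<omega> * cond_mass M (G n) (X (Suc n)) k \<omega> \<partial>M)"
      unfolding cond_mass_def using real_cond_exp_intg(2)[OF int f g] by simp
    also have "\<dots> = (\<integral>\<omega>. 0 \<partial>M)"
      using X_mass[of n k] fM
      by (intro integral_cong_AE borel_measurable_times)
        (auto simp: hypergeometric_mass_def cond_mass_def)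
    finally have "AE \<omega> in M. ?f \<omega> * ?g \<omega> = 0"
      by (subst integral_nonneg_eq_0_iff_AE[symmetric]) (use int in auto)
    with AE_space show ?thesis by eventually_elim auto
  qed
  then have "AE \<omega> in M. \<forall>k. \<not> (X (Suc n) \<omega> = k \<and> N (Suc n) \<omega> < k)"
    unfolding AE_all_countable by blast
  then show ?thesis by eventually_elim auto
qed

end

section \<open>Essentially bounded functions\<close>

text \<open>The bound C holds only outside null sets. This class is closed under the arithmetic used
  below and consists of integrable functions on a finite measure space, so integrability needs no
  separate estimates.\<close>

definition ae_bounded :: "'a measure \<Rightarrow> ('a \<Rightarrow> real) \<Rightarrow> bool" where
  "ae_bounded M f \<longleftrightarrow> f \<in> borel_measurable M \<and> (\<exists>c. AE x in M. \<bar>f x\<bar> \<le> c)"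

lemma ae_boundedI: "f \<in> borel_measurable M \<Longrightarrow> AE x in M. \<bar>f x\<bar> \<le> c \<Longrightarrow> ae_bounded M f"
  by (auto simp: ae_bounded_def)

lemma ae_bounded_measurable: "ae_bounded M f \<Longrightarrow> f \<in> borel_measurable M"
  by (auto simp: ae_bounded_def)

lemma ae_bounded_const: "ae_bounded M (\<lambda>_. c)"
  by (auto simp: ae_bounded_def)

lemma ae_bounded_add:
  assumes "ae_bounded M f" "ae_bounded M g"
  shows "ae_bounded M (\<lambda>x. f x + g x)"
proof -
  obtain c d where "AE x in M. \<bar>f x\<bar> \<le> c" "AE x in M. \<bar>g x\<bar> \<le> d"
    using assms by (auto simp: ae_bounded_def)
  then have "AE x in M. \<bar>f x + g x\<bar> \<le> c + d" by eventually_elim linarith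
  then show ?thesis using assms by (intro ae_boundedI) (auto simp: ae_bounded_def)
qed

lemma ae_bounded_mult:
  assumes "ae_bounded M f" "ae_bounded M g"
  shows "ae_bounded M (\<lambda>x. f x * g x)"
proof -
  obtain c d where "AE x in M. \<bar>f x\<bar> \<le> c" "AE x in M. \<bar>g x\<bar> \<le> d"
    using assms by (auto simp: ae_bounded_def)
  then have "AE x in M. \<bar>f x * g x\<bar> \<le> c * d"
    by eventually_elim (auto simp: abs_mult intro: mult_mono')
  then show ?thesis using assms by (intro ae_boundedI) (auto simp: ae_bounded_def)
qed

lemma ae_bounded_diff:
  assumes "ae_bounded M f" "ae_bounded M g"
  shows "ae_bounded M (\<lambda>x. f x - g x)"
  using ae_bounded_add[OF assms(1) ae_bounded_mult[OF ae_bounded_const[of _ "-1"] assms(2)]] by simp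

lemma ae_bounded_power: "ae_bounded M f \<Longrightarrow> ae_bounded M (\<lambda>x. f x ^ n)"
  by (induction n) (auto intro: ae_bounded_const ae_bounded_mult)

lemma ae_bounded_sum: "(\<And>i. i \<in> I \<Longrightarrow> ae_bounded M (f i)) \<Longrightarrow> ae_bounded M (\<lambda>x. \<Sum>i\<in>I. f i x)"
  by (induction I rule: infinite_finite_induct) (auto intro: ae_bounded_const ae_bounded_add)

lemmas ae_bounded_intros = ae_bounded_const ae_bounded_add ae_bounded_mult ae_bounded_diff
  ae_bounded_power ae_bounded_sum

lemma (in finite_measure) ae_bounded_integrable: "ae_bounded M f \<Longrightarrow> integrable M f"
  unfolding ae_bounded_def using integrable_const_bound[of f] by auto

section \<open>One step of a bounded urn\<close>

text \<open>Put t = s + u + v and x = k u - h v. The increment is x / (s t) and the linear part is x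
  / s^2, so they differ by x (u + v) / (s^2 t). Then |x| \<le> s (u + v) and t \<ge> s give the
  square.\<close>

lemma proportion_increment:
  fixes h k u v :: real
  assumes pos: "h \<ge> 0" "k \<ge> 0" "h + k > 0" "u \<ge> 0" "v \<ge> 0"
  defines "s \<equiv> h + k"
  shows "\<bar>(h + u) / (s + u + v) - h / s - (u * (k / s\<^sup>2) - v * (h / s\<^sup>2))\<bar> \<le> ((u + v) / s)\<^sup>2"
proof -
  define t where "t = s + u + v"
  define x where "x = k * u - h * v"
  have s: "s > 0" and st: "s \<le> t" using pos by (auto simp: s_def t_def)
  then have t: "t > 0" by simp
  have "(h + u) / t - h / s = ((h + u) * s - h * t) / (t * s)"
    using s t by (simp add: diff_frac_eq)
  also have "(h + u) * s - h * t = x"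
    unfolding t_def x_def s_def by algebra
  also have "x / (t * s) = x * s / (s\<^sup>2 * t)"
    using s by (simp add: power2_eq_square)
  finally have 1: "(h + u) / t - h / s = x * s / (s\<^sup>2 * t)" .
  have 2: "u * (k / s\<^sup>2) - v * (h / s\<^sup>2) = x * t / (s\<^sup>2 * t)"
    using t by (simp add: x_def diff_divide_distrib mult.commute)
  have "x * s / (s\<^sup>2 * t) - x * t / (s\<^sup>2 * t) = - (x * (u + v) / (s\<^sup>2 * t))"
    unfolding diff_divide_distrib[symmetric] minus_divide_left t_def by (simp add: algebra_simps)
  then have "\<bar>(h + u) / t - h / s - (u * (k / s\<^sup>2) - v * (h / s\<^sup>2))\<bar> = \<bar>x\<bar> * (u + v) / (s\<^sup>2 * t)"
    unfolding 1 2 using pos s t by (simp add: abs_mult)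
  also have "\<dots> \<le> (s * (u + v)) * (u + v) / (s\<^sup>2 * s)"
  proof (intro frac_le mult_right_mono mult_left_mono)
    have "k * u \<le> s * u" "h * v \<le> s * v" "0 \<le> k * u" "0 \<le> h * v"
      using pos by (auto simp: s_def intro: mult_right_mono)
    then show "\<bar>x\<bar> \<le> s * (u + v)" unfolding distrib_left x_def by linarith
  qed (use pos s st in auto)
  also have "\<dots> = ((u + v) / s)\<^sup>2"
    using s by (simp add: power2_eq_square)
  finally show ?thesis by (simp add: t_def)
qed

locale bounded_urn = urn_model M a b N X A B
  for M :: "'w measure" and a b :: nat and N X A B :: "nat \<Rightarrow> 'w \<Rightarrow> nat" +
  fixes C :: nat and m :: "nat \<Rightarrow> real"
  assumes bound: "\<And>n. n \<ge> 1 \<Longrightarrow> AE \<omega> in M. max (max (A n \<omega>) (B n \<omega>)) (N n \<omega>) \<le> C"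
    and mean_A: "\<And>n. n \<ge> 1 \<Longrightarrow> (\<integral>\<omega>. real (A n \<omega>) \<partial>M) = m n"
    and mean_B: "\<And>n. n \<ge> 1 \<Longrightarrow> (\<integral>\<omega>. real (B n \<omega>) \<partial>M) = m n"
begin

text \<open>The hypothesis sums conditional masses up to the random index \<open>S n\<close>. The
  bound C turns this into a fixed finite sum weighted by \<open>F n\<close>-measurable indicators,
  which can be integrated term by term.\<close>

lemma AE_N_range: "AE \<omega> in M. 1 \<le> N (Suc n) \<omega> \<and> N (Suc n) \<omega> \<le> S n \<omega>"
proof -
  interpret finite_measure_subalgebra M "F n" using subalgebra_M_F by unfold_locales
  let ?g = "\<lambda>k. indicator {\<omega> \<in> space M. N (Suc n) \<omega> = k} :: 'w \<Rightarrow> real"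
  let ?f = "\<lambda>k \<omega>. if real k \<le> real (S n \<omega>) then 1 else 0 :: real"
  have f: "?f k \<in> borel_measurable (F n)" for k by measurable
  have fM: "?f k \<in> borel_measurable M" for k using measurable_from_subalg[OF subalgebra_M_F f] .
  have g: "?g k \<in> borel_measurable M" for k using rv_N[of n] by measurable
  have int: "integrable M (\<lambda>\<omega>. ?f k \<omega> * ?g k \<omega>)" for k
    by (rule integrable_const_bound[where B=1])
      (use borel_measurable_times[OF fM g] in \<open>auto simp: indicator_def\<close>)
  have bnd: "AE \<omega> in M. N (Suc n) \<omega> \<le> C" using bound[of "Suc n"] by auto
  have "AE \<omega> in M. k > C \<longrightarrow> cond_mass M (F n) (N (Suc n)) k \<omega> = 0" for k
  proof (cases "k > C")
    case True
    have "AE \<omega> in M. ?g k \<omega> = 0" using bnd by eventually_elim (use True in auto)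
    then have "AE \<omega> in M. real_cond_exp M (F n) (?g k) \<omega> = real_cond_exp M (F n) (\<lambda>_. 0) \<omega>"
      using g by (intro real_cond_exp_cong) auto
    moreover have "AE \<omega> in M. real_cond_exp M (F n) (\<lambda>_. 0) \<omega> = 0"
      by (rule real_cond_exp_F_meas) auto
    ultimately show ?thesis unfolding cond_mass_def by eventually_elim simp
  qed simp
  then have "AE \<omega> in M. \<forall>k. k > C \<longrightarrow> cond_mass M (F n) (N (Suc n)) k \<omega> = 0"
    unfolding AE_all_countable by blast
  \<comment> \<open>Indices in 1..C above \<open>S n\<close> are killed by the factor
    \<open>?f\<close>, and indices in 1..\<open>S n\<close> above C carry no conditional
    mass.\<close>
  with N_conc[of n] have sum1: "AE \<omega> in M. (\<Sum>k=1..C. ?f k \<omega> * cond_mass M (F n) (N (Suc n)) k \<omega>) = 1"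
  proof eventually_elim
    case (elim \<omega>)
    have "(\<Sum>k=1..C. ?f k \<omega> * cond_mass M (F n) (N (Suc n)) k \<omega>)
        = (\<Sum>k=1..S n \<omega>. cond_mass M (F n) (N (Suc n)) k \<omega>)"
      by (rule sum.mono_neutral_cong) (use elim(2) in auto)
    with elim(1) show ?case by simp
  qed
  have int': "integrable M (\<lambda>\<omega>. ?f k \<omega> * cond_mass M (F n) (N (Suc n)) k \<omega>)" for k
    unfolding cond_mass_def by (rule real_cond_exp_intg(1)[OF int f g])
  \<comment> \<open>\<open>W\<close> is the indicator of the wanted event intersected with N \<le>
    C. Its mean is 1, so \<open>1 - W\<close> is nonnegative with integral 0.\<close>
  define W where "W \<omega> = (\<Sum>k=1..C. ?f k \<omega> * ?g k \<omega>)" for \<omega>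
  have W: "integrable M W" unfolding W_def[abs_def] by (intro Bochner_Integration.integrable_sum int)
  have "(\<integral>\<omega>. W \<omega> \<partial>M) = (\<Sum>k=1..C. \<integral>\<omega>. ?f k \<omega> * ?g k \<omega> \<partial>M)"
    unfolding W_def by (intro Bochner_Integration.integral_sum int)
  also have "\<dots> = (\<Sum>k=1..C. \<integral>\<omega>. ?f k \<omega> * cond_mass M (F n) (N (Suc n)) k \<omega> \<partial>M)"
    unfolding cond_mass_def using real_cond_exp_intg(2)[OF int f g] by simp
  also have "\<dots> = (\<integral>\<omega>. (\<Sum>k=1..C. ?f k \<omega> * cond_mass M (F n) (N (Suc n)) k \<omega>) \<partial>M)"
    using int' by (intro Bochner_Integration.integral_sum[symmetric])
  also have "\<dots> = (\<integral>\<omega>. 1 \<partial>M)"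
    using sum1 int' by (intro integral_cong_AE) (auto intro!: borel_measurable_sum)
  finally have one: "(\<integral>\<omega>. 1 - W \<omega> \<partial>M) = 0"
    using W by (simp add: prob_space)
  have val: "W \<omega>
      = (if 1 \<le> N (Suc n) \<omega> \<and> N (Suc n) \<omega> \<le> S n \<omega> \<and> N (Suc n) \<omega> \<le> C then 1 else 0)"
    if "\<omega> \<in> space M" for \<omega>
  proof -
    have "W \<omega> = (\<Sum>k=1..C. if k = N (Suc n) \<omega> then ?f k \<omega> else 0)"
      unfolding W_def using that by (intro sum.cong) auto
    also have "\<dots> = (if N (Suc n) \<omega> \<in> {1..C} then ?f (N (Suc n) \<omega>) \<omega> else 0)"
      by (rule sum.delta) simp
    finally show ?thesis by auto
  qed
  have "AE \<omega> in M. 1 - W \<omega> = 0"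
  proof (subst integral_nonneg_eq_0_iff_AE[symmetric])
    show "integrable M (\<lambda>\<omega>. 1 - W \<omega>)" using W by simp
    show "AE \<omega> in M. 0 \<le> 1 - W \<omega>"
      using AE_space by eventually_elim (simp add: val)
  qed (rule one)
  with AE_space show ?thesis
    by eventually_elim (auto simp: val split: if_splits)
qed

text \<open>One event of probability one for all times at once, so that the estimates on paths
  become pointwise.\<close>

definition regular :: "'w \<Rightarrow> bool" where
  "regular \<omega> \<longleftrightarrow> (\<forall>n. 1 \<le> N (Suc n) \<omega> \<and> N (Suc n) \<omega> \<le> C \<and> N (Suc n) \<omega> \<le> S n \<omega> \<and>
     X (Suc n) \<omega> \<le> N (Suc n) \<omega> \<and> 1 \<le> A (Suc n) \<omega> \<and> A (Suc n) \<omega> \<le> C \<and>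
     1 \<le> B (Suc n) \<omega> \<and> B (Suc n) \<omega> \<le> C)"

lemma AE_regular: "AE \<omega> in M. regular \<omega>"
  unfolding regular_def AE_all_countable
proof
  fix n
  have "1 \<le> Suc n" by simp
  from bound[OF this] AE_N_range[of n] AE_X_le_N[of n] AB_pos[of n]
  show "AE \<omega> in M. 1 \<le> N (Suc n) \<omega> \<and> N (Suc n) \<omega> \<le> C \<and> N (Suc n) \<omega> \<le> S n \<omega> \<and>
     X (Suc n) \<omega> \<le> N (Suc n) \<omega> \<and> 1 \<le> A (Suc n) \<omega> \<and> A (Suc n) \<omega> \<le> C \<and>
     1 \<le> B (Suc n) \<omega> \<and> B (Suc n) \<omega> \<le> C"
    by eventually_elim auto
qed

section \<open>Growth of the urn and size of its increments\<close>

lemma H_Suc: "H (Suc n) \<omega> = H n \<omega> + A (Suc n) \<omega> * X (Suc n) \<omega>"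
  by (simp add: H_def)

lemma S_Suc: "S (Suc n) \<omega> = S n \<omega> + A (Suc n) \<omega> * X (Suc n) \<omega> + B (Suc n) \<omega> * (N (Suc n) \<omega> - X (Suc n) \<omega>)"
  by (simp add: S_def H_def K_def)

text \<open>The urn starts with at least two balls; each sample is nonempty, and every sampled ball
  brings at least one new ball.\<close>

lemma S_lower: "regular \<omega> \<Longrightarrow> n + 2 \<le> S n \<omega>"
proof (induction n)
  case 0
  then show ?case using a_pos b_pos by (simp add: S_def H_def K_def)
next
  case (Suc n)
  have r: "1 \<le> N (Suc n) \<omega>" "X (Suc n) \<omega> \<le> N (Suc n) \<omega>" "1 \<le> A (Suc n) \<omega>" "1 \<le> B (Suc n) \<omega>"
    using Suc.prems by (auto simp: regular_def)
  have "X (Suc n) \<omega> \<le> A (Suc n) \<omega> * X (Suc n) \<omega>"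
    "N (Suc n) \<omega> - X (Suc n) \<omega> \<le> B (Suc n) \<omega> * (N (Suc n) \<omega> - X (Suc n) \<omega>)"
    using r by simp_all
  then show ?case
    unfolding S_Suc using Suc.IH[OF Suc.prems] r(1,2) by linarith
qed

lemma S_pos: "S n \<omega> > 0"
  using a_pos by (simp add: S_def H_def)

lemma Z_range: "0 \<le> Z n \<omega>" "Z n \<omega> \<le> 1"
  using S_pos[of n \<omega>] by (auto simp: Z_def S_def)

text \<open>The linearisation of the increment of \<open>Z\<close> at time \<open>n + 1\<close>: the size of the urn in the
  denominator is frozen at time \<open>n\<close>.\<close>

definition V :: "nat \<Rightarrow> 'w \<Rightarrow> real" where
  "V n \<omega> = real (A (Suc n) \<omega>) * real (X (Suc n) \<omega>) * (real (K n \<omega>) / (real (S n \<omega>))\<^sup>2)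
    - real (B (Suc n) \<omega>) * (real (N (Suc n) \<omega>) - real (X (Suc n) \<omega>)) * (real (H n \<omega>) / (real (S n \<omega>))\<^sup>2)"

lemma regular_real:
  assumes "regular \<omega>"
  shows "0 \<le> real (N (Suc n) \<omega>) - real (X (Suc n) \<omega>)"
    and "real (N (Suc n) \<omega>) - real (X (Suc n) \<omega>) = real (N (Suc n) \<omega> - X (Suc n) \<omega>)"
    and "real (N (Suc n) \<omega>) - real (X (Suc n) \<omega>) \<le> real (N (Suc n) \<omega>)"
    and "real (X (Suc n) \<omega>) \<le> real (N (Suc n) \<omega>)"
    and "real (N (Suc n) \<omega>) \<le> real C" "real (A (Suc n) \<omega>) \<le> real C" "real (B (Suc n) \<omega>) \<le> real C"
  using assms by (auto simp: regular_def of_nat_diff)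

lemma V_bound:
  assumes "regular \<omega>"
  shows "\<bar>V n \<omega>\<bar> \<le> (real C)\<^sup>2 / (real n + 1)"
proof -
  note r = regular_real[OF assms, of n]
  let ?s = "real (S n \<omega>)"
  have s: "real n + 1 \<le> ?s" using S_lower[OF assms, of n] by simp
  \<comment> \<open>Both terms of \<open>V\<close> lie between 0 and the same bound, so their
    difference obeys it without a factor 2.\<close>
  have part: "0 \<le> u * (x / ?s\<^sup>2) \<and> u * (x / ?s\<^sup>2) \<le> (real C)\<^sup>2 / (real n + 1)"
    if "0 \<le> u" "u \<le> (real C)\<^sup>2" "0 \<le> x" "x \<le> ?s" for u x
  proof -
    have "x / ?s\<^sup>2 \<le> ?s / ?s\<^sup>2" using that by (intro divide_right_mono) auto
    also have "\<dots> = 1 / ?s" by (simp add: power2_eq_square)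
    also have "\<dots> \<le> 1 / (real n + 1)" using s by (intro divide_left_mono) auto
    finally have "u * (x / ?s\<^sup>2) \<le> (real C)\<^sup>2 * (1 / (real n + 1))"
      using that by (intro mult_mono) auto
    then show ?thesis using that by simp
  qed
  have "real (A (Suc n) \<omega>) * real (X (Suc n) \<omega>) \<le> (real C)\<^sup>2"
    "real (B (Suc n) \<omega>) * (real (N (Suc n) \<omega>) - real (X (Suc n) \<omega>)) \<le> (real C)\<^sup>2"
    unfolding power2_eq_square using r by (intro mult_mono; linarith)+
  note uv = this
  have S: "real (K n \<omega>) \<le> ?s" "real (H n \<omega>) \<le> ?s" by (simp_all add: S_def)
  have nonneg: "0 \<le> real (A (Suc n) \<omega>) * real (X (Suc n) \<omega>)"
    "0 \<le> real (B (Suc n) \<omega>) * (real (N (Suc n) \<omega>) - real (X (Suc n) \<omega>))"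
    using r(1) by (intro mult_nonneg_nonneg; simp)+
  show ?thesis
    using part[OF nonneg(1) uv(1) of_nat_0_le_iff S(1)] part[OF nonneg(2) uv(2) of_nat_0_le_iff S(2)]
    unfolding V_def by linarith
qed

text \<open>Both colour counts of the sample are at most N, so at most N (A + B) balls are added.
  The bound is arranged as a \<open>G n\<close>-measurable factor times a function of the added
  balls, ready for conditioning.\<close>

lemma remainder_bound:
  assumes "regular \<omega>"
  shows "\<bar>Z (Suc n) \<omega> - Z n \<omega> - V n \<omega>\<bar>
    \<le> (real (N (Suc n) \<omega>))\<^sup>2 / (real n + 1)\<^sup>2 * (real (A (Suc n) \<omega>) + real (B (Suc n) \<omega>))\<^sup>2"
proof -
  note r = regular_real[OF assms, of n]
  define h k w x y where "h = real (H n \<omega>)" and "k = real (K n \<omega>)"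
    and "w = real (N (Suc n) \<omega>)" and "x = real (A (Suc n) \<omega>)" and "y = real (B (Suc n) \<omega>)"
  define u v where "u = x * real (X (Suc n) \<omega>)" and "v = y * (w - real (X (Suc n) \<omega>))"
  note defs = h_def k_def w_def x_def y_def u_def v_def
  have s: "real n + 1 \<le> h + k" using S_lower[OF assms, of n] by (simp add: S_def defs)
  have pos: "0 \<le> h" "0 \<le> k" "0 \<le> u" "0 \<le> v"
    using r(1) unfolding defs by (simp_all only: of_nat_0_le_iff mult_nonneg_nonneg)
  have S: "real (S n \<omega>) = h + k" "real (S (Suc n) \<omega>) = h + k + u + v" "real (H (Suc n) \<omega>) = h + u"
    unfolding defs S_Suc H_Suc of_nat_add of_nat_mult r(2) by (simp_all add: S_def)
  have "u \<le> x * w" "v \<le> y * w"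
    unfolding u_def v_def using r(3,4) by (intro mult_left_mono; simp add: defs)+
  then have "u + v \<le> w * (x + y)" by (simp add: distrib_left mult.commute)
  then have "(u + v) / (h + k) \<le> w * (x + y) / (real n + 1)"
    using s pos by (intro frac_le) auto
  then have "((u + v) / (h + k))\<^sup>2 \<le> (w * (x + y) / (real n + 1))\<^sup>2"
    using pos by (intro power_mono) auto
  moreover have "\<bar>(h + u) / (h + k + u + v) - h / (h + k) - (u * (k / (h + k)\<^sup>2) - v * (h / (h + k)\<^sup>2))\<bar>
      \<le> ((u + v) / (h + k))\<^sup>2"
    using pos s by (intro proportion_increment) auto
  moreover have "Z (Suc n) \<omega> = (h + u) / (h + k + u + v)" "Z n \<omega> = h / (h + k)"
    unfolding Z_def S by (simp_all add: h_def)
  moreover have "V n \<omega> = u * (k / (h + k)\<^sup>2) - v * (h / (h + k)\<^sup>2)"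
    unfolding V_def S by (simp only: defs)
  ultimately show ?thesis
    unfolding w_def[symmetric] x_def[symmetric] y_def[symmetric]
    by (simp only: power_mult_distrib power_divide times_divide_eq_left)
qed

section \<open>The linear part of an increment\<close>

sublocale GE: finite_measure_subalgebra M "G n" for n
  using subalgebra_M_G by unfold_locales

lemma borel_measurable_G_M: "f \<in> borel_measurable (G n) \<Longrightarrow> f \<in> borel_measurable M"
  by (rule measurable_from_subalg[OF subalgebra_M_G])

lemma borel_measurable_F_G: "f \<in> borel_measurable (F n) \<Longrightarrow> f \<in> borel_measurable (G n)"
  by (rule measurable_from_subalg[OF subalgebra_G_F])

lemma measurable_real_N_G: "(\<lambda>\<omega>. real (N (Suc n) \<omega>)) \<in> borel_measurable (G n)"
  by (rule measurable_compose[OF measurable_G_N]) simp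

lemma measurable_urn_M:
  "(\<lambda>\<omega>. real (N (Suc n) \<omega>)) \<in> borel_measurable M"
  "(\<lambda>\<omega>. real (X (Suc n) \<omega>)) \<in> borel_measurable M"
  "(\<lambda>\<omega>. real (A (Suc n) \<omega>)) \<in> borel_measurable M"
  "(\<lambda>\<omega>. real (B (Suc n) \<omega>)) \<in> borel_measurable M"
  by (rule measurable_compose[OF rv_N] measurable_compose[OF rv_X]
      measurable_compose[OF rv_A] measurable_compose[OF rv_B]; simp)+

lemma ae_bounded_urn:
  "ae_bounded M (\<lambda>\<omega>. real (N (Suc n) \<omega>))" "ae_bounded M (\<lambda>\<omega>. real (X (Suc n) \<omega>))"
  "ae_bounded M (\<lambda>\<omega>. real (A (Suc n) \<omega>))" "ae_bounded M (\<lambda>\<omega>. real (B (Suc n) \<omega>))"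
proof -
  have "\<bar>real (N (Suc n) \<omega>)\<bar> \<le> real C" "\<bar>real (X (Suc n) \<omega>)\<bar> \<le> real C"
    "\<bar>real (A (Suc n) \<omega>)\<bar> \<le> real C" "\<bar>real (B (Suc n) \<omega>)\<bar> \<le> real C" if "regular \<omega>" for \<omega>
    using regular_real(4-7)[OF that, of n] by linarith+
  note bounds = this[THEN eventually_mono[OF AE_regular, rotated]]
  show "ae_bounded M (\<lambda>\<omega>. real (N (Suc n) \<omega>))" "ae_bounded M (\<lambda>\<omega>. real (X (Suc n) \<omega>))"
    "ae_bounded M (\<lambda>\<omega>. real (A (Suc n) \<omega>))" "ae_bounded M (\<lambda>\<omega>. real (B (Suc n) \<omega>))"
    using ae_boundedI[OF measurable_urn_M(1) bounds(1)] ae_boundedI[OF measurable_urn_M(2) bounds(2)]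
      ae_boundedI[OF measurable_urn_M(3) bounds(3)] ae_boundedI[OF measurable_urn_M(4) bounds(4)]
    by simp_all
qed

lemma measurable_fractions:
  "(\<lambda>\<omega>. real (K n \<omega>) / (real (S n \<omega>))\<^sup>2) \<in> borel_measurable (F n)"
  "(\<lambda>\<omega>. real (H n \<omega>) / (real (S n \<omega>))\<^sup>2) \<in> borel_measurable (F n)"
  "(\<lambda>\<omega>. real (H n \<omega>) / real (S n \<omega>)) \<in> borel_measurable (F n)"
  by (intro borel_measurable_divide borel_measurable_power measurable_urn)+

lemma measurable_F_M: "f \<in> borel_measurable (F n) \<Longrightarrow> f \<in> borel_measurable M"
  by (rule measurable_from_subalg[OF subalgebra_M_F])

lemma ae_bounded_fractions:
  "ae_bounded M (\<lambda>\<omega>. real (K n \<omega>) / (real (S n \<omega>))\<^sup>2)"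
  "ae_bounded M (\<lambda>\<omega>. real (H n \<omega>) / (real (S n \<omega>))\<^sup>2)"
  "ae_bounded M (\<lambda>\<omega>. real (H n \<omega>) / real (S n \<omega>))"
proof -
  have *: "\<bar>x / s\<^sup>2\<bar> \<le> 1" "\<bar>x / s\<bar> \<le> 1" if "0 \<le> x" "x \<le> s" "1 \<le> s" for x s :: real
  proof -
    have "x \<le> s\<^sup>2" using that self_le_power[of s 2] by linarith
    then show "\<bar>x / s\<^sup>2\<bar> \<le> 1" "\<bar>x / s\<bar> \<le> 1" using that by simp_all
  qed
  have HK: "real (K n \<omega>) \<le> real (S n \<omega>)" "real (H n \<omega>) \<le> real (S n \<omega>)" for \<omega>
    by (simp_all add: S_def)
  have S1: "1 \<le> real (S n \<omega>)" for \<omega> using S_pos[of n \<omega>] by simp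
  show "ae_bounded M (\<lambda>\<omega>. real (K n \<omega>) / (real (S n \<omega>))\<^sup>2)"
    by (rule ae_boundedI[OF measurable_F_M[OF measurable_fractions(1)]], rule AE_I2,
        rule *(1)[OF of_nat_0_le_iff HK(1) S1])
  show "ae_bounded M (\<lambda>\<omega>. real (H n \<omega>) / (real (S n \<omega>))\<^sup>2)"
    by (rule ae_boundedI[OF measurable_F_M[OF measurable_fractions(2)]], rule AE_I2,
        rule *(1)[OF of_nat_0_le_iff HK(2) S1])
  show "ae_bounded M (\<lambda>\<omega>. real (H n \<omega>) / real (S n \<omega>))"
    by (rule ae_boundedI[OF measurable_F_M[OF measurable_fractions(3)]], rule AE_I2,
        rule *(2)[OF of_nat_0_le_iff HK(2) S1])
qed

text \<open>Weak form of E[X | G] = N H / S. Almost surely X \<le> C, so X is a finite combination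
  of indicators; their conditional masses are then replaced by the hypergeometric ones, whose mean
  is known.\<close>

lemma integral_X:
  assumes g: "g \<in> borel_measurable (G n)" "ae_bounded M g"
  shows "(\<integral>\<omega>. g \<omega> * real (X (Suc n) \<omega>) \<partial>M)
    = (\<integral>\<omega>. g \<omega> * (real (N (Suc n) \<omega>) * (real (H n \<omega>) / real (S n \<omega>))) \<partial>M)"
proof -
  let ?i = "\<lambda>k. indicator {\<omega> \<in> space M. X (Suc n) \<omega> = k} :: 'w \<Rightarrow> real"
  have i: "?i k \<in> borel_measurable M" for k using rv_X[of n] by measurable
  have ib: "ae_bounded M (?i k)" for k
    by (rule ae_boundedI[OF i, of k 1]) (simp add: indicator_def)
  have int: "integrable M (\<lambda>\<omega>. g \<omega> * ?i k \<omega>)" for k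
    by (intro ae_bounded_integrable ae_bounded_mult g ib)
  note ce = GE.real_cond_exp_intg[OF int g(1) i, folded cond_mass_def]
  have "(\<integral>\<omega>. g \<omega> * real (X (Suc n) \<omega>) \<partial>M) = (\<integral>\<omega>. (\<Sum>k\<le>C. real k * (g \<omega> * ?i k \<omega>)) \<partial>M)"
  proof (rule integral_cong_AE)
    show "(\<lambda>\<omega>. g \<omega> * real (X (Suc n) \<omega>)) \<in> borel_measurable M"
      by (intro borel_measurable_times measurable_urn_M ae_bounded_measurable g)
    show "(\<lambda>\<omega>. \<Sum>k\<le>C. real k * (g \<omega> * ?i k \<omega>)) \<in> borel_measurable M"
      by (intro borel_measurable_sum borel_measurable_times borel_measurable_const
          ae_bounded_measurable[OF g(2)] i)
    show "AE \<omega> in M. g \<omega> * real (X (Suc n) \<omega>) = (\<Sum>k\<le>C. real k * (g \<omega> * ?i k \<omega>))"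
      using AE_regular AE_space
    proof eventually_elim
      case (elim \<omega>)
      have le: "X (Suc n) \<omega> \<le> C" using regular_real(4,5)[OF elim(1), of n] by linarith
      have "(\<Sum>k\<le>C. real k * (g \<omega> * ?i k \<omega>))
          = (\<Sum>k\<le>C. if k = X (Suc n) \<omega> then g \<omega> * real k else 0)"
        using elim(2) by (intro sum.cong) auto
      also have "\<dots> = g \<omega> * real (X (Suc n) \<omega>)"
        using le by (subst sum.delta) auto
      finally show ?case by simp
    qed
  qed
  also have "\<dots> = (\<Sum>k\<le>C. real k * (\<integral>\<omega>. g \<omega> * ?i k \<omega> \<partial>M))"
    using int by (subst Bochner_Integration.integral_sum) auto
  also have "\<dots> = (\<Sum>k\<le>C. real k * (\<integral>\<omega>. g \<omega> * cond_mass M (G n) (X (Suc n)) k \<omega> \<partial>M))"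
    by (simp only: ce(2))
  also have "\<dots> = (\<integral>\<omega>. (\<Sum>k\<le>C. real k * (g \<omega> * cond_mass M (G n) (X (Suc n)) k \<omega>)) \<partial>M)"
    using ce(1) by (subst Bochner_Integration.integral_sum) auto
  also have "\<dots> = (\<integral>\<omega>. g \<omega> * (real (N (Suc n) \<omega>) * (real (H n \<omega>) / real (S n \<omega>))) \<partial>M)"
  proof (rule integral_cong_AE)
    show "(\<lambda>\<omega>. \<Sum>k\<le>C. real k * (g \<omega> * cond_mass M (G n) (X (Suc n)) k \<omega>)) \<in> borel_measurable M"
      by (intro borel_measurable_sum borel_measurable_times[OF borel_measurable_const]
          borel_measurable_integrable ce(1))
    show "(\<lambda>\<omega>. g \<omega> * (real (N (Suc n) \<omega>) * (real (H n \<omega>) / real (S n \<omega>)))) \<in> borel_measurable M"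
      by (intro borel_measurable_times measurable_urn_M ae_bounded_measurable g
          measurable_F_M[OF measurable_fractions(3)])
    have "AE \<omega> in M. \<forall>k. cond_mass M (G n) (X (Suc n)) k \<omega>
        = hypergeometric_mass (N (Suc n) \<omega>) (S n \<omega>) (H n \<omega>) k"
      using X_mass unfolding AE_all_countable by blast
    then show "AE \<omega> in M. (\<Sum>k\<le>C. real k * (g \<omega> * cond_mass M (G n) (X (Suc n)) k \<omega>))
        = g \<omega> * (real (N (Suc n) \<omega>) * (real (H n \<omega>) / real (S n \<omega>)))"
      using AE_regular
    proof eventually_elim
      case (elim \<omega>)
      have "1 \<le> N (Suc n) \<omega>" "N (Suc n) \<omega> \<le> S n \<omega>" "N (Suc n) \<omega> \<le> C"
        using elim(2) unfolding regular_def by blast+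
      then have "(\<Sum>k\<le>C. real k * hypergeometric_mass (N (Suc n) \<omega>) (S n \<omega>) (H n \<omega>) k)
          = real (N (Suc n) \<omega>) * real (H n \<omega>) / real (S n \<omega>)"
        by (intro hypergeometric_mass_mean) (auto simp: S_def)
      then show ?case
        using elim(1) by (simp add: mult.left_commute[of _ "g \<omega>"] sum_distrib_left[symmetric])
    qed
  qed
  finally show ?thesis .
qed

text \<open>The factor h may depend on the composition of the sample, hence \<open>obs n\<close>
  instead of \<open>G n\<close>.\<close>

lemma integral_added_mult:
  fixes f :: "nat \<Rightarrow> nat \<Rightarrow> real"
  assumes "ae_bounded M (\<lambda>\<omega>. f (A (Suc n) \<omega>) (B (Suc n) \<omega>))"
    and "h \<in> borel_measurable (sigma_gen M (obs n))" "ae_bounded M h"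
  shows "(\<integral>\<omega>. f (A (Suc n) \<omega>) (B (Suc n) \<omega>) * h \<omega> \<partial>M)
    = (\<integral>\<omega>. f (A (Suc n) \<omega>) (B (Suc n) \<omega>) \<partial>M) * (\<integral>\<omega>. h \<omega> \<partial>M)"
  by (rule indep_set_integral_mult[OF AB_indep[of n] subalgebra_M_added subalgebra_M_obs
        measurable_added[of f n] ae_bounded_integrable[OF assms(1)] assms(2)
        ae_bounded_integrable[OF assms(3)]])

lemma ae_bounded_V: "ae_bounded M (V n)"
  unfolding V_def[abs_def] by (intro ae_bounded_intros ae_bounded_urn ae_bounded_fractions)

text \<open>The numbers \<open>A\<close> and \<open>B\<close> have the same mean and are independent of the sample, whose
  expected composition given \<^term>\<open>G n\<close> is that of the urn.\<close>

lemma integral_mult_V: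
  assumes g: "g \<in> borel_measurable (G n)" "ae_bounded M g"
  shows "(\<integral>\<omega>. g \<omega> * V n \<omega> \<partial>M) = 0"
proof -
  let ?p = "\<lambda>\<omega>. real (K n \<omega>) / (real (S n \<omega>))\<^sup>2" and ?q = "\<lambda>\<omega>. real (H n \<omega>) / (real (S n \<omega>))\<^sup>2"
  let ?N = "\<lambda>\<omega>. real (N (Suc n) \<omega>)" and ?X = "\<lambda>\<omega>. real (X (Suc n) \<omega>)"
  let ?A = "\<lambda>\<omega>. real (A (Suc n) \<omega>)" and ?B = "\<lambda>\<omega>. real (B (Suc n) \<omega>)"
  let ?z = "\<lambda>\<omega>. real (H n \<omega>) / real (S n \<omega>)"
  note bdd = ae_bounded_intros ae_bounded_urn ae_bounded_fractions g(2)
  note mG = borel_measurable_times borel_measurable_diff measurable_real_N_G g(1)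
    borel_measurable_F_G[OF measurable_fractions(1)] borel_measurable_F_G[OF measurable_fractions(2)]
  have Xobs: "?X \<in> borel_measurable (sigma_gen M (obs n))"
    by (rule measurable_compose[OF measurable_obs_X]) simp
  have Gobs: "f \<in> borel_measurable (sigma_gen M (obs n))" if "f \<in> borel_measurable (G n)" for f :: "'w \<Rightarrow> real"
    using that by (rule measurable_from_subalg[OF subalgebra_obs_G])
  have m: "(\<integral>\<omega>. ?A \<omega> \<partial>M) = m (Suc n)" "(\<integral>\<omega>. ?B \<omega> \<partial>M) = m (Suc n)"
    using mean_A mean_B by auto
  have "(\<integral>\<omega>. ?A \<omega> * ((g \<omega> * ?p \<omega>) * ?X \<omega>) \<partial>M) = m (Suc n) * (\<integral>\<omega>. (g \<omega> * ?p \<omega>) * ?X \<omega> \<partial>M)"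
    unfolding m(1)[symmetric]
    by (rule integral_added_mult[where f="\<lambda>x y. real x"])
      (intro bdd borel_measurable_times[OF Gobs Xobs] mG)+
  also have "(\<integral>\<omega>. (g \<omega> * ?p \<omega>) * ?X \<omega> \<partial>M) = (\<integral>\<omega>. (g \<omega> * ?p \<omega>) * (?N \<omega> * ?z \<omega>) \<partial>M)"
    by (intro integral_X bdd mG)
  finally have IA: "(\<integral>\<omega>. ?A \<omega> * ((g \<omega> * ?p \<omega>) * ?X \<omega>) \<partial>M)
      = m (Suc n) * (\<integral>\<omega>. (g \<omega> * ?p \<omega>) * (?N \<omega> * ?z \<omega>) \<partial>M)" .
  have "(\<integral>\<omega>. ?B \<omega> * ((g \<omega> * ?q \<omega>) * (?N \<omega> - ?X \<omega>)) \<partial>M)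
      = m (Suc n) * (\<integral>\<omega>. (g \<omega> * ?q \<omega>) * (?N \<omega> - ?X \<omega>) \<partial>M)"
    unfolding m(2)[symmetric]
    by (rule integral_added_mult[where f="\<lambda>x y. real y"])
      (intro bdd borel_measurable_times[OF Gobs] borel_measurable_diff[OF Gobs Xobs] mG)+
  also have "(\<integral>\<omega>. (g \<omega> * ?q \<omega>) * (?N \<omega> - ?X \<omega>) \<partial>M)
      = (\<integral>\<omega>. (g \<omega> * ?q \<omega>) * ?N \<omega> \<partial>M) - (\<integral>\<omega>. (g \<omega> * ?q \<omega>) * ?X \<omega> \<partial>M)"
    unfolding right_diff_distrib
    by (intro Bochner_Integration.integral_diff ae_bounded_integrable bdd)
  also have "(\<integral>\<omega>. (g \<omega> * ?q \<omega>) * ?X \<omega> \<partial>M) = (\<integral>\<omega>. (g \<omega> * ?q \<omega>) * (?N \<omega> * ?z \<omega>) \<partial>M)"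
    by (intro integral_X bdd mG)
  also have "(\<integral>\<omega>. (g \<omega> * ?q \<omega>) * ?N \<omega> \<partial>M) - \<dots>
      = (\<integral>\<omega>. (g \<omega> * ?q \<omega>) * ?N \<omega> - (g \<omega> * ?q \<omega>) * (?N \<omega> * ?z \<omega>) \<partial>M)"
    by (intro Bochner_Integration.integral_diff[symmetric] ae_bounded_integrable bdd)
  also have "(\<lambda>\<omega>. (g \<omega> * ?q \<omega>) * ?N \<omega> - (g \<omega> * ?q \<omega>) * (?N \<omega> * ?z \<omega>))
      = (\<lambda>\<omega>. (g \<omega> * ?p \<omega>) * (?N \<omega> * ?z \<omega>))"
  proof
    fix \<omega>
    have s: "real (S n \<omega>) \<noteq> 0" using S_pos[of n \<omega>] by simp
    then have "1 - ?z \<omega> = real (K n \<omega>) / real (S n \<omega>)"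
      by (simp add: field_simps S_def)
    \<comment> \<open>Both sides equal H K / S^3. This is the cancellation that makes
      \<open>V\<close> centred: the second colour is drawn in proportion 1 - H/S, and its additions
      are weighted by H.\<close>
    then have "?q \<omega> * (1 - ?z \<omega>) = ?p \<omega> * ?z \<omega>" by simp
    moreover have "c * y * x - c * y * (x * z) = c * p * (x * z)" if "y * (1 - z) = p * z" for c y x z p :: real
      using that by algebra
    ultimately show "(g \<omega> * ?q \<omega>) * ?N \<omega> - (g \<omega> * ?q \<omega>) * (?N \<omega> * ?z \<omega>) = (g \<omega> * ?p \<omega>) * (?N \<omega> * ?z \<omega>)"
      by blast
  qed
  finally have IB: "(\<integral>\<omega>. ?B \<omega> * ((g \<omega> * ?q \<omega>) * (?N \<omega> - ?X \<omega>)) \<partial>M)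
      = m (Suc n) * (\<integral>\<omega>. (g \<omega> * ?p \<omega>) * (?N \<omega> * ?z \<omega>) \<partial>M)" .
  have "g * (a * x * p - b * y * q) = a * (g * p * x) - b * (g * q * y)" for g a x p b y q :: real
    by algebra
  then have "(\<integral>\<omega>. g \<omega> * V n \<omega> \<partial>M)
      = (\<integral>\<omega>. ?A \<omega> * ((g \<omega> * ?p \<omega>) * ?X \<omega>) - ?B \<omega> * ((g \<omega> * ?q \<omega>) * (?N \<omega> - ?X \<omega>)) \<partial>M)"
    unfolding V_def by (simp only:)
  also have "\<dots> = (\<integral>\<omega>. ?A \<omega> * ((g \<omega> * ?p \<omega>) * ?X \<omega>) \<partial>M) - (\<integral>\<omega>. ?B \<omega> * ((g \<omega> * ?q \<omega>) * (?N \<omega> - ?X \<omega>)) \<partial>M)"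
    by (intro Bochner_Integration.integral_diff ae_bounded_integrable bdd)
  also have "\<dots> = 0" unfolding IA IB by simp
  finally show ?thesis .
qed

lemma real_cond_exp_V: "AE \<omega> in M. real_cond_exp M (G n) (V n) \<omega> = 0"
proof (rule GE.real_cond_exp_charact)
  fix D assume D: "D \<in> sets (G n)"
  have "(\<integral>\<omega>. indicator D \<omega> * V n \<omega> \<partial>M) = 0"
    using D by (intro integral_mult_V ae_boundedI[where c=1] borel_measurable_G_M[of _ n]) (auto simp: indicator_def)
  then show "(\<integral>\<omega>\<in>D. V n \<omega> \<partial>M) = (\<integral>\<omega>\<in>D. 0 \<partial>M)"
    by (simp add: set_lebesgue_integral_def)
qed (auto intro: ae_bounded_integrable ae_bounded_V)

section \<open>Quasi-martingale property and convergence\<close>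

lemma ae_bounded_Z: "ae_bounded M (Z n)"
  by (rule ae_boundedI[OF measurable_F_M[OF measurable_urn(4)], of _ 1]) (simp add: Z_range)

lemma measurable_Z_G: "Z n \<in> borel_measurable (G n)"
  by (rule borel_measurable_F_G[OF measurable_urn(4)])

text \<open>Z at the next time lies between Z + V - w q and Z + V + w q. Conditioning removes V,
  leaves w outside, and turns q into its mean. The denominator n + 1 also covers time 0, where the
  quasi-martingale sum starts.\<close>

lemma real_cond_exp_Z_bound:
  "AE \<omega> in M. \<bar>real_cond_exp M (G n) (Z (Suc n)) \<omega> - Z n \<omega>\<bar>
    \<le> (\<integral>\<omega>'. (real (A (Suc n) \<omega>') + real (B (Suc n) \<omega>'))\<^sup>2 \<partial>M)
      * ((real (N (Suc n) \<omega>))\<^sup>2 / (real n + 1)\<^sup>2)"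
proof -
  let ?w = "\<lambda>\<omega>. (real (N (Suc n) \<omega>))\<^sup>2 / (real n + 1)\<^sup>2"
  let ?q = "\<lambda>\<omega>. (real (A (Suc n) \<omega>) + real (B (Suc n) \<omega>))\<^sup>2"
  have q: "ae_bounded M ?q" by (intro ae_bounded_intros ae_bounded_urn)
  have "ae_bounded M (\<lambda>\<omega>. (real (N (Suc n) \<omega>))\<^sup>2 * inverse ((real n + 1)\<^sup>2))"
    by (intro ae_bounded_intros ae_bounded_urn)
  then have w: "ae_bounded M ?w" by (simp add: divide_inverse)
  have wG: "?w \<in> borel_measurable (G n)"
    by (intro borel_measurable_divide borel_measurable_power borel_measurable_const measurable_real_N_G)
  have "AE \<omega> in M. real_cond_exp M (G n) ?q \<omega> = (\<integral>\<omega>'. ?q \<omega>' \<partial>M)"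
    by (rule indep_set_real_cond_exp[OF AB_indep[of n] subalgebra_M_added subalgebra_M_obs _ subalgebra_M_G
          measurable_added ae_bounded_integrable[OF q]])
      (use subalgebra_obs_G[of n] in \<open>simp add: subalgebra_def\<close>)
  moreover have "AE \<omega> in M. real_cond_exp M (G n) (\<lambda>\<omega>. ?w \<omega> * ?q \<omega>) \<omega> = ?w \<omega> * real_cond_exp M (G n) ?q \<omega>"
    by (intro GE.real_cond_exp_mult wG ae_bounded_measurable[OF q] ae_bounded_integrable ae_bounded_mult w q)
  ultimately have Eq: "AE \<omega> in M. real_cond_exp M (G n) (\<lambda>\<omega>. ?w \<omega> * ?q \<omega>) \<omega> = ?w \<omega> * (\<integral>\<omega>'. ?q \<omega>' \<partial>M)"
    by eventually_elim simp
  have iQ: "integrable M (\<lambda>\<omega>. ?w \<omega> * ?q \<omega>)" by (intro ae_bounded_integrable ae_bounded_mult w q)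
  have iZ: "integrable M (Z k)" and iV: "integrable M (V k)" for k
    by (intro ae_bounded_integrable ae_bounded_Z ae_bounded_V)+
  have "AE \<omega> in M. real_cond_exp M (G n) (\<lambda>\<omega>. Z n \<omega> + V n \<omega>) \<omega>
      = real_cond_exp M (G n) (Z n) \<omega> + real_cond_exp M (G n) (V n) \<omega>"
    by (rule GE.real_cond_exp_add[OF iZ iV])
  moreover have "AE \<omega> in M. real_cond_exp M (G n) (Z n) \<omega> = Z n \<omega>"
    by (rule GE.real_cond_exp_F_meas[OF iZ measurable_Z_G])
  ultimately have EZ: "AE \<omega> in M. real_cond_exp M (G n) (\<lambda>\<omega>. Z n \<omega> + V n \<omega>) \<omega> = Z n \<omega>"
    using real_cond_exp_V[of n] by eventually_elim simp
  have iZV: "integrable M (\<lambda>\<omega>. Z n \<omega> + V n \<omega>)" using iZ iV by simp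
  have "AE \<omega> in M. Z (Suc n) \<omega> \<le> (Z n \<omega> + V n \<omega>) + ?w \<omega> * ?q \<omega>"
    using AE_regular by eventually_elim (use remainder_bound in \<open>smt (verit)\<close>)
  then have "AE \<omega> in M. real_cond_exp M (G n) (Z (Suc n)) \<omega>
      \<le> real_cond_exp M (G n) (\<lambda>\<omega>. (Z n \<omega> + V n \<omega>) + ?w \<omega> * ?q \<omega>) \<omega>"
    by (rule GE.real_cond_exp_mono[OF _ iZ Bochner_Integration.integrable_add[OF iZV iQ]])
  moreover have "AE \<omega> in M. Z (Suc n) \<omega> \<ge> (Z n \<omega> + V n \<omega>) - ?w \<omega> * ?q \<omega>"
    using AE_regular by eventually_elim (use remainder_bound in \<open>smt (verit)\<close>)
  then have "AE \<omega> in M. real_cond_exp M (G n) (Z (Suc n)) \<omega>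
      \<ge> real_cond_exp M (G n) (\<lambda>\<omega>. (Z n \<omega> + V n \<omega>) - ?w \<omega> * ?q \<omega>) \<omega>"
    by (rule GE.real_cond_exp_mono[OF _ Bochner_Integration.integrable_diff[OF iZV iQ] iZ])
  moreover have "AE \<omega> in M. real_cond_exp M (G n) (\<lambda>\<omega>. (Z n \<omega> + V n \<omega>) + ?w \<omega> * ?q \<omega>) \<omega>
      = real_cond_exp M (G n) (\<lambda>\<omega>. Z n \<omega> + V n \<omega>) \<omega> + real_cond_exp M (G n) (\<lambda>\<omega>. ?w \<omega> * ?q \<omega>) \<omega>"
    by (rule GE.real_cond_exp_add[OF iZV iQ])
  moreover have "AE \<omega> in M. real_cond_exp M (G n) (\<lambda>\<omega>. (Z n \<omega> + V n \<omega>) - ?w \<omega> * ?q \<omega>) \<omega>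
      = real_cond_exp M (G n) (\<lambda>\<omega>. Z n \<omega> + V n \<omega>) \<omega> - real_cond_exp M (G n) (\<lambda>\<omega>. ?w \<omega> * ?q \<omega>) \<omega>"
    by (rule GE.real_cond_exp_diff[OF iZV iQ])
  ultimately show ?thesis
    using EZ Eq
  proof eventually_elim
    case (elim \<omega>)
    have "real_cond_exp M (G n) (Z (Suc n)) \<omega> \<le> Z n \<omega> + ?w \<omega> * (\<integral>\<omega>'. ?q \<omega>' \<partial>M)"
      "Z n \<omega> - ?w \<omega> * (\<integral>\<omega>'. ?q \<omega>' \<partial>M) \<le> real_cond_exp M (G n) (Z (Suc n)) \<omega>"
      using elim by simp_all
    then show ?case unfolding mult.commute[of "\<integral>\<omega>'. ?q \<omega>' \<partial>M"] by linarith
  qed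
qed

lemma quasi_martingale_Z: "quasi_martingale M G Z"
  unfolding quasi_martingale_def
proof (intro conjI allI)
  show "filtration (space M) G"
    by unfold_locales (use subalgebra_G_mono in \<open>auto simp: subalgebra_def\<close>)
  show "subalgebra M (G n)" "Z n \<in> borel_measurable (G n)" "integrable M (Z n)" for n
    by (intro subalgebra_M_G measurable_Z_G ae_bounded_integrable ae_bounded_Z)+
  show "summable (\<lambda>n. \<integral>\<omega>. \<bar>real_cond_exp M (G n) (Z (Suc n)) \<omega> - Z n \<omega>\<bar> \<partial>M)"
  proof (rule summable_comparison_test'[OF summable_over_square])
    \<comment> \<open>The first factor bounds (A + B)^2, the second N^2.\<close>
    let ?D = "(2 * real C)\<^sup>2 * (real C)\<^sup>2"
    show "norm (\<integral>\<omega>. \<bar>real_cond_exp M (G n) (Z (Suc n)) \<omega> - Z n \<omega>\<bar> \<partial>M) \<le> ?D / (real n + 1)\<^sup>2" for n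
    proof -
      let ?e = "\<integral>\<omega>'. (real (A (Suc n) \<omega>') + real (B (Suc n) \<omega>'))\<^sup>2 \<partial>M"
      have iq: "integrable M (\<lambda>\<omega>'. (real (A (Suc n) \<omega>') + real (B (Suc n) \<omega>'))\<^sup>2)"
        by (intro ae_bounded_integrable ae_bounded_intros ae_bounded_urn)
      have "AE \<omega> in M. (real (A (Suc n) \<omega>) + real (B (Suc n) \<omega>))\<^sup>2 \<le> (2 * real C)\<^sup>2"
        using AE_regular
      proof eventually_elim
        case (elim \<omega>)
        show ?case using regular_real(6,7)[OF elim, of n] by (intro power_mono) auto
      qed
      then have "?e \<le> (\<integral>\<omega>. (2 * real C)\<^sup>2 \<partial>M)"
        by (intro integral_mono_AE iq) auto
      then have e: "?e \<le> (2 * real C)\<^sup>2" by (simp add: prob_space)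
      have "AE \<omega> in M. \<bar>real_cond_exp M (G n) (Z (Suc n)) \<omega> - Z n \<omega>\<bar> \<le> ?D / (real n + 1)\<^sup>2"
        using AE_regular real_cond_exp_Z_bound[of n]
      proof eventually_elim
        case (elim \<omega>)
        have "(real (N (Suc n) \<omega>))\<^sup>2 \<le> (real C)\<^sup>2"
          using regular_real(5)[OF elim(1), of n] by (intro power_mono) auto
        then have "?e * ((real (N (Suc n) \<omega>))\<^sup>2 / (real n + 1)\<^sup>2) \<le> (2 * real C)\<^sup>2 * ((real C)\<^sup>2 / (real n + 1)\<^sup>2)"
          using e by (intro mult_mono divide_right_mono) auto
        with elim(2) show ?case by simp
      qed
      then have "(\<integral>\<omega>. \<bar>real_cond_exp M (G n) (Z (Suc n)) \<omega> - Z n \<omega>\<bar> \<partial>M) \<le> (\<integral>\<omega>. ?D / (real n + 1)\<^sup>2 \<partial>M)"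
        by (intro integral_mono_AE[OF _ integrable_const] integrable_abs Bochner_Integration.integrable_diff GE.real_cond_exp_int(1)
            ae_bounded_integrable ae_bounded_Z) auto
      then show ?thesis by (simp add: prob_space)
    qed
  qed
qed

section \<open>Orthogonality and almost sure convergence\<close>

lemma measurable_V: "V n \<in> borel_measurable (F (Suc n))"
proof -
  have "real \<circ> f \<in> borel_measurable (F (Suc n))" if "f \<in> measurable (F (Suc n)) (count_space UNIV)" for f :: "'w \<Rightarrow> nat"
    unfolding comp_def using that by (rule measurable_compose) simp
  note real = this[OF measurable_F(1)[OF lessI], unfolded comp_def] this[OF measurable_F(2)[OF lessI], unfolded comp_def]
    this[OF measurable_F(3)[OF lessI], unfolded comp_def] this[OF measurable_F(4)[OF lessI], unfolded comp_def]
  have F: "f \<in> borel_measurable (F (Suc n))" if "f \<in> borel_measurable (F n)" for f :: "'w \<Rightarrow> real"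
    using that by (rule measurable_from_subalg[OF subalgebra_F_mono[OF le_SucI[OF order_refl]]])
  show ?thesis
    unfolding V_def[abs_def]
    by (intro borel_measurable_diff borel_measurable_times real F[OF measurable_fractions(1)] F[OF measurable_fractions(2)])
qed

lemma measurable_V_G: "i < n \<Longrightarrow> V i \<in> borel_measurable (G n)"
  by (rule borel_measurable_F_G, rule measurable_from_subalg[OF subalgebra_F_mono measurable_V]) simp

text \<open>The sum up to q is bounded and \<open>G q\<close>-measurable, so its product with
  \<open>V q\<close> integrates to 0. Each remaining square is at most the value C^4 / (p + 1)^2
  allowed at the left end.\<close>

lemma second_moment_sum_V:
  assumes "p \<le> q"
  shows "(\<integral>\<omega>. (\<Sum>i=p..<q. V i \<omega>)\<^sup>2 \<partial>M) \<le> (real q - real p) * ((real C) ^ 4 / (real p + 1)\<^sup>2)"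
  using assms
proof (induction q rule: dec_induct)
  case (step q)
  let ?W = "\<lambda>\<omega>. \<Sum>i=p..<q. V i \<omega>"
  have W: "ae_bounded M ?W" by (intro ae_bounded_sum ae_bounded_V)
  have "(\<integral>\<omega>. (\<Sum>i=p..<Suc q. V i \<omega>)\<^sup>2 \<partial>M) = (\<integral>\<omega>. ((?W \<omega>)\<^sup>2 + 2 * (?W \<omega> * V q \<omega>)) + (V q \<omega>)\<^sup>2 \<partial>M)"
    using step(1) by (simp add: power2_sum algebra_simps)
  also have "\<dots> = ((\<integral>\<omega>. (?W \<omega>)\<^sup>2 \<partial>M) + 2 * (\<integral>\<omega>. ?W \<omega> * V q \<omega> \<partial>M)) + (\<integral>\<omega>. (V q \<omega>)\<^sup>2 \<partial>M)"
    by (subst Bochner_Integration.integral_add, intro ae_bounded_integrable ae_bounded_intros W ae_bounded_V,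
        intro ae_bounded_integrable ae_bounded_intros W ae_bounded_V,
        subst Bochner_Integration.integral_add, intro ae_bounded_integrable ae_bounded_intros W ae_bounded_V,
        intro ae_bounded_integrable ae_bounded_intros W ae_bounded_V) simp
  also have "(\<integral>\<omega>. ?W \<omega> * V q \<omega> \<partial>M) = 0"
    by (intro integral_mult_V W borel_measurable_sum measurable_V_G) simp
  also have "(\<integral>\<omega>. (V q \<omega>)\<^sup>2 \<partial>M) \<le> (\<integral>\<omega>. (real C) ^ 4 / (real p + 1)\<^sup>2 \<partial>M)"
  proof (rule integral_mono_AE)
    show "integrable M (\<lambda>\<omega>. (V q \<omega>)\<^sup>2)" by (intro ae_bounded_integrable ae_bounded_power ae_bounded_V)
    show "AE \<omega> in M. (V q \<omega>)\<^sup>2 \<le> (real C) ^ 4 / (real p + 1)\<^sup>2"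
      using AE_regular
    proof eventually_elim
      case (elim \<omega>)
      have "\<bar>V q \<omega>\<bar> \<le> (real C)\<^sup>2 / (real q + 1)" by (rule V_bound[OF elim])
      also have "\<dots> \<le> (real C)\<^sup>2 / (real p + 1)" using step(1) by (intro divide_left_mono) auto
      finally have "\<bar>V q \<omega>\<bar>\<^sup>2 \<le> ((real C)\<^sup>2 / (real p + 1))\<^sup>2" by (intro power_mono) auto
      then show ?case by (simp add: power_divide flip: power_mult)
    qed
  qed simp
  finally have "(\<integral>\<omega>. (\<Sum>i=p..<Suc q. V i \<omega>)\<^sup>2 \<partial>M)
      \<le> (real q - real p) * ((real C) ^ 4 / (real p + 1)\<^sup>2) + (real C) ^ 4 / (real p + 1)\<^sup>2"
    using step.IH by (simp add: prob_space)
  moreover have "(real q - real p) * c + c = (real (Suc q) - real p) * c" for c :: real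
    by (simp add: algebra_simps)
  ultimately show ?case by (simp only:)
qed simp

lemma AE_convergent_sum_V: "AE \<omega> in M. convergent (\<lambda>n. \<Sum>i<n. V i \<omega>)"
proof -
  let ?Y = "\<lambda>j \<omega>. \<Sum>i=(j + 1) ^ 3..<(j + 2) ^ 3. V i \<omega>"
  let ?f = "\<lambda>j \<omega>. (real j + 1)\<^sup>2 * (?Y j \<omega>)\<^sup>2"
  have le: "(j + 1) ^ 3 \<le> (j + 2) ^ 3" for j :: nat by (rule power_mono) auto
  have "AE \<omega> in M. summable (\<lambda>j. ?f j \<omega>)"
  proof (rule AE_summable_of_summable_integral)
    show "integrable M (?f j)" for j
      by (intro ae_bounded_integrable ae_bounded_intros ae_bounded_V)
    show "?f j \<omega> \<ge> 0" for j \<omega> by simp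
    show "summable (\<lambda>j. \<integral>\<omega>. ?f j \<omega> \<partial>M)"
    proof (rule summable_comparison_test'[OF summable_over_square[of "7 * (real C) ^ 4"]])
      fix j
      define r where "r = real j + 1"
      have r: "r > 0" "real ((j + 1) ^ 3) = r ^ 3" by (simp_all add: r_def add.commute)
      have "(\<integral>\<omega>. ?f j \<omega> \<partial>M) = r\<^sup>2 * (\<integral>\<omega>. (?Y j \<omega>)\<^sup>2 \<partial>M)" by (simp add: r_def)
      also have "\<dots> \<le> r\<^sup>2 * ((real ((j + 2) ^ 3) - real ((j + 1) ^ 3)) * ((real C) ^ 4 / (real ((j + 1) ^ 3) + 1)\<^sup>2))"
        by (intro mult_left_mono second_moment_sum_V le) simp
      \<comment> \<open>The weight r^2 times the block length 7 r^2 against r^6 leaves 1 /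
        r^2.\<close>
      also have "\<dots> \<le> r\<^sup>2 * ((7 * r\<^sup>2) * ((real C) ^ 4 / (r ^ 3)\<^sup>2))"
        unfolding r(2)
      proof (intro mult_left_mono mult_mono)
        show "real ((j + 2) ^ 3) - r ^ 3 \<le> 7 * r\<^sup>2" using cube_gap[of j] unfolding r(2) r_def[symmetric] .
        show "(real C) ^ 4 / (r ^ 3 + 1)\<^sup>2 \<le> (real C) ^ 4 / (r ^ 3)\<^sup>2"
          using r(1) by (intro divide_left_mono power_mono mult_pos_pos zero_less_power add_pos_pos) auto
      qed auto
      also have "\<dots> = 7 * (real C) ^ 4 / r\<^sup>2"
        using r(1) by (simp add: power2_eq_square power3_eq_cube)
      finally show "norm (\<integral>\<omega>. ?f j \<omega> \<partial>M) \<le> 7 * (real C) ^ 4 / (real j + 1)\<^sup>2"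
        by (simp add: r_def)
    qed
  qed
  then show ?thesis
    using AE_regular
  proof eventually_elim
    case (elim \<omega>)
    have "summable (\<lambda>j. ?Y j \<omega>)"
    proof (rule summable_comparison_test'[OF summable_add[OF elim(1) summable_over_square[of 1]]])
      fix j
      define r where "r = real j + 1"
      define y where "y = \<bar>?Y j \<omega>\<bar>"
      have r: "r > 0" by (simp add: r_def)
      have y: "y \<ge> 0" by (simp add: y_def)
      \<comment> \<open>The arithmetic-geometric mean inequality replaces a square root of the
        second moment: the weight r^2 is paid for by the summable 1 / r^2.\<close>
      have "2 * (r * y) * (1 / r) \<le> (r * y)\<^sup>2 + (1 / r)\<^sup>2" by (rule sum_squares_bound)
      then have "2 * y \<le> r\<^sup>2 * y\<^sup>2 + 1 / r\<^sup>2"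
        using r by (simp add: power_mult_distrib power_divide)
      with y have "y \<le> r\<^sup>2 * y\<^sup>2 + 1 / r\<^sup>2" by linarith
      then show "norm (?Y j \<omega>) \<le> ?f j \<omega> + 1 / (real j + 1)\<^sup>2"
        by (simp add: y_def r_def)
    qed
    \<comment> \<open>The blocks start at 1^3 = 1, so the term of index 0 is added by hand.\<close>
    then have "convergent (\<lambda>k. V 0 \<omega> + (\<Sum>j<k. ?Y j \<omega>))"
      by (intro convergent_add convergent_const) (simp add: summable_iff_convergent)
    moreover have "V 0 \<omega> + (\<Sum>j<k. ?Y j \<omega>) = (\<Sum>i<(k + 1) ^ 3. V i \<omega>)" for k
    proof (induction k)
      case (Suc k)
      have "(\<Sum>i<(Suc k + 1) ^ 3. V i \<omega>) = (\<Sum>i<(k + 1) ^ 3. V i \<omega>) + ?Y k \<omega>"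
        using sum.atLeastLessThan_concat[of 0 "(k + 1) ^ 3" "(k + 2) ^ 3" "\<lambda>i. V i \<omega>"] le[of k]
        by (simp add: atLeast0LessThan)
      then show ?case using Suc.IH by simp
    qed simp
    ultimately have "convergent (\<lambda>k. \<Sum>i<(k + 1) ^ 3. V i \<omega>)" by simp
    then show ?case
      by (rule convergent_from_cubes[rotated, where c="(real C)\<^sup>2"]) (use V_bound[OF elim(2)] in simp)
  qed
qed

text \<open>Telescoping writes \<open>Z n\<close> as \<open>Z 0\<close> plus the partial sums of
  \<open>V\<close> and of the remainders; on the regular event the latter converge
  absolutely.\<close>

lemma AE_convergent_Z: "AE \<omega> in M. convergent (\<lambda>n. Z n \<omega>)"
  using AE_convergent_sum_V AE_regular
proof eventually_elim
  case (elim \<omega>)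
  let ?R = "\<lambda>n. Z (Suc n) \<omega> - Z n \<omega> - V n \<omega>" and ?D = "(real C)\<^sup>2 * (2 * real C)\<^sup>2"
  have "summable ?R"
  proof (rule summable_comparison_test'[OF summable_over_square])
    show "norm (?R n) \<le> ?D / (real n + 1)\<^sup>2" for n
    proof -
      note r = regular_real[OF elim(2), of n]
      have "\<bar>?R n\<bar> \<le> (real (N (Suc n) \<omega>))\<^sup>2 / (real n + 1)\<^sup>2 * (real (A (Suc n) \<omega>) + real (B (Suc n) \<omega>))\<^sup>2"
        by (rule remainder_bound[OF elim(2)])
      also have "\<dots> \<le> (real C)\<^sup>2 / (real n + 1)\<^sup>2 * (2 * real C)\<^sup>2"
        using r(5-7) by (intro mult_mono divide_right_mono power_mono) auto
      finally show ?thesis by simp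
    qed
  qed
  then have "convergent (\<lambda>n. Z 0 \<omega> + ((\<Sum>i<n. V i \<omega>) + (\<Sum>i<n. ?R i)))"
    using elim(1) by (intro convergent_add convergent_const) (simp_all add: summable_iff_convergent)
  moreover have "Z 0 \<omega> + ((\<Sum>i<n. V i \<omega>) + (\<Sum>i<n. ?R i)) = Z n \<omega>" for n
    by (induction n) auto
  ultimately show ?case by simp
qed

text \<open>Clipping the limit to [0,1] gives values in the interval at every outcome, including
  those where \<open>Z\<close> may diverge, and changes nothing where it converges.\<close>

lemma exists_limit_Z:
  "\<exists>Y. Y \<in> borel_measurable M \<and> (\<forall>\<omega>\<in>space M. Y \<omega> \<in> {0..1}) \<and> (AE \<omega> in M. (\<lambda>n. Z n \<omega>) \<longlonglongrightarrow> Y \<omega>)"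
proof (intro exI conjI ballI)
  let ?Y = "\<lambda>\<omega>. min 1 (max 0 (lim (\<lambda>n. Z n \<omega>)))"
  have [measurable]: "Z n \<in> borel_measurable M" for n by (rule measurable_F_M[OF measurable_urn(4)])
  show "?Y \<in> borel_measurable M" by measurable
  show "?Y \<omega> \<in> {0..1}" for \<omega> by simp
  show "AE \<omega> in M. (\<lambda>n. Z n \<omega>) \<longlonglongrightarrow> ?Y \<omega>"
    using AE_convergent_Z
  proof eventually_elim
    case (elim \<omega>)
    then have l: "(\<lambda>n. Z n \<omega>) \<longlonglongrightarrow> lim (\<lambda>n. Z n \<omega>)" by (simp add: convergent_LIMSEQ_iff)
    moreover have "0 \<le> lim (\<lambda>n. Z n \<omega>)" "lim (\<lambda>n. Z n \<omega>) \<le> 1"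
      using LIMSEQ_le_const[OF l, of 0] LIMSEQ_le_const2[OF l, of 1] Z_range by auto
    ultimately show ?case by simp
  qed
qed

end

theorem theorem3p3:
  fixes M :: "'w measure" and a b C :: nat and N X A B :: "nat \<Rightarrow> 'w \<Rightarrow> nat"
    and m :: "nat \<Rightarrow> real" and m_lim :: real
  assumes urn: "urn_model M a b N X A B"
    and bound: "\<And>n. n \<ge> 1 \<Longrightarrow> AE \<omega> in M. max (max (A n \<omega>) (B n \<omega>)) (N n \<omega>) \<le> C"
    and mean_A: "\<And>n. n \<ge> 1 \<Longrightarrow> (\<integral>\<omega>. real (A n \<omega>) \<partial>M) = m n"
    and mean_B: "\<And>n. n \<ge> 1 \<Longrightarrow> (\<integral>\<omega>. real (B n \<omega>) \<partial>M) = m n"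
    and m_lim: "m \<longlonglongrightarrow> m_lim" and m_lim_pos: "m_lim > 0"
  shows "(\<forall>n\<ge>1. AE \<omega> in M.
            \<bar>real_cond_exp M (urn_process.G M N X A B n)
                (urn_process.Z a b N X A B (Suc n)) \<omega> - urn_process.Z a b N X A B n \<omega>\<bar>
            \<le> (\<integral>\<omega>'. (real (A (Suc n) \<omega>') + real (B (Suc n) \<omega>'))\<^sup>2 \<partial>M)
                * ((real (N (Suc n) \<omega>))\<^sup>2 / (real n)\<^sup>2)) \<and>
         quasi_martingale M (urn_process.G M N X A B) (urn_process.Z a b N X A B) \<and>
         (\<exists>Z. Z \<in> borel_measurable M \<and> (\<forall>\<omega>\<in>space M. Z \<omega> \<in> {0..1}) \<and>
            (AE \<omega> in M. (\<lambda>n. urn_process.Z a b N X A B n \<omega>) \<longlonglongrightarrow> Z \<omega>))"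
proof -
  interpret bounded_urn M a b N X A B C m
    by (intro bounded_urn.intro bounded_urn_axioms.intro urn bound mean_A mean_B)
  have "AE \<omega> in M. \<bar>real_cond_exp M (G n) (Z (Suc n)) \<omega> - Z n \<omega>\<bar>
      \<le> (\<integral>\<omega>'. (real (A (Suc n) \<omega>') + real (B (Suc n) \<omega>'))\<^sup>2 \<partial>M)
        * ((real (N (Suc n) \<omega>))\<^sup>2 / (real n)\<^sup>2)" if "n \<ge> 1" for n
    using real_cond_exp_Z_bound[of n]
  proof eventually_elim
    case (elim \<omega>)
    \<comment> \<open>The sharper denominator n + 1 is relaxed to n; n \<ge> 1 keeps the division
      meaningful.\<close>
    have "(real (N (Suc n) \<omega>))\<^sup>2 / (real n + 1)\<^sup>2 \<le> (real (N (Suc n) \<omega>))\<^sup>2 / (real n)\<^sup>2"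
      using that by (intro divide_left_mono power_mono) auto
    then have "(\<integral>\<omega>'. (real (A (Suc n) \<omega>') + real (B (Suc n) \<omega>'))\<^sup>2 \<partial>M) * ((real (N (Suc n) \<omega>))\<^sup>2 / (real n + 1)\<^sup>2)
        \<le> (\<integral>\<omega>'. (real (A (Suc n) \<omega>') + real (B (Suc n) \<omega>'))\<^sup>2 \<partial>M) * ((real (N (Suc n) \<omega>))\<^sup>2 / (real n)\<^sup>2)"
      by (intro mult_left_mono) auto
    with elim show ?case by linarith
  qed
  then show ?thesis using quasi_martingale_Z exists_limit_Z by blast
qed

end
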